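(* Let $n\ge3$, $d\ge2$ and let $V\in\mathcal{B}_p\cap\mathcal{ND}\cap\mathcal{NC}$ for some $p>\frac n2$. Then there is a constant $C$, depending only on $d,n,p,C_V,N_V$, such that for every compactly supported $C^1$ function $\vec u:\mathbb{R}^n\to\mathbb{R}^d$, $$\int_{\mathbb{R}^n}|\underline m(x,V)\vec u(x)|^2\,dx\le C\left(\int_{\mathbb{R}^n}|D\vec u(x)|^2\,dx+\int_{\mathbb{R}^n}|V^{1/2}(x)\vec u(x)|^2\,dx\right).$$
   Context: A matrix weight is a $d\times d$ real symmetric positive semidefinite measurable matrix function on $\mathbb{R}^n$. $Q(x,r)$ is the axis-parallel cube with center $x$ and side length $2r$. $V\in\mathcal{B}_p$ if $V$ is a matrix weight, $V\in L^p_{loc}(\mathbb{R}^n)$ and there is $C_V$ with $\big(\frac1{|Q|}\int_Q\langle V\vec e,\vec e\rangle^p\big)^{1/p}\le C_V\big\langle\big(\frac1{|Q|}\int_QV\big)\vec e,\vec e\big\rangle$ for all cubes $Q$ and $\vec e\in\mathbb{R}^d$. $V\in\mathcal{ND}$ if $V(E):=\int_EV$ is positive definite for every measurable $E$ with $|E|>0$. With $\Psi(x,r;V)=r^{2-n}\int_{Q(x,r)}V(y)\,dy$, the lower auxiliary function $\underline m(x,V)\in(0,\infty)$ is defined by $\frac1{\underline m(x,V)}=\sup\{r>0:\min_{\vec e\in\mathbb{S}^{d-1}}\langle\Psi(x,r;V)\vec e,\vec e\rangle\le1\}$. $V\in\mathcal{NC}$ if there is $N_V>0$ so that $N_V|\vec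 e|^2\le\int_Q\langle V^{1/2}(y)V(Q)^{-1}V^{1/2}(y)\vec e,\vec e\rangle\,dy$ for all $x\in\mathbb{R}^n$, $\vec e\in\mathbb{R}^d$, where $Q=Q(x,1/\underline m(x,V))$. *)

theory Defs
  imports "HOL-Analysis.Analysis"
begin

definition psd_matrix :: "real^'d^'d \<Rightarrow> bool" where
  "psd_matrix A \<longleftrightarrow> transpose A = A \<and> (\<forall>e. 0 \<le> (A *v e) \<bullet> e)"

definition pd_matrix :: "real^'d^'d \<Rightarrow> bool" where
  "pd_matrix A \<longleftrightarrow> transpose A = A \<and> (\<forall>e. e \<noteq> 0 \<longrightarrow> 0 < (A *v e) \<bullet> e)"

text \<open>The principal square root; meaningful only for positive semidefinite arguments.\<close>

definition msqrt :: "real^'d^'d \<Rightarrow> real^'d^'d" where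
  "msqrt A = (THE B. psd_matrix B \<and> B ** B = A)"

definition matrix_weight :: "(real^'n \<Rightarrow> real^'d^'d) \<Rightarrow> bool" where
  "matrix_weight V \<longleftrightarrow> V \<in> borel_measurable lebesgue \<and> (\<forall>x. psd_matrix (V x))"

text \<open>Centre \<open>x\<close>, side length \<open>2 * r\<close>.\<close>

definition cube :: "real^'n \<Rightarrow> real \<Rightarrow> (real^'n) set" where
  "cube x r = cbox (\<chi> i. x $ i - r) (\<chi> i. x $ i + r)"

definition Lp_loc :: "real \<Rightarrow> (real^'n \<Rightarrow> real^'d^'d) set" where
  "Lp_loc p = {V. V \<in> borel_measurable lebesgue \<and>
     (\<forall>K. compact K \<longrightarrow> set_integrable lebesgue K (\<lambda>y. norm (V y) powr p))}"

definition weight_of :: "(real^'n \<Rightarrow> real^'d^'d) \<Rightarrow> (real^'n) set \<Rightarrow> real^'d^'d" where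
  "weight_of V E = (LINT y:E|lebesgue. V y)"

definition Bp_const :: "real \<Rightarrow> (real^'n \<Rightarrow> real^'d^'d) \<Rightarrow> real \<Rightarrow> bool" where
  "Bp_const p V C \<longleftrightarrow> (\<forall>x r e. 0 < r \<longrightarrow>
     ((1 / measure lebesgue (cube x r)) *
        (LINT y:cube x r|lebesgue. ((V y *v e) \<bullet> e) powr p)) powr (1 / p)
     \<le> C * ((((1 / measure lebesgue (cube x r)) *\<^sub>R weight_of V (cube x r)) *v e) \<bullet> e))"

definition Bp_class :: "real \<Rightarrow> (real^'n \<Rightarrow> real^'d^'d) set" where
  "Bp_class p = {V. matrix_weight V \<and> V \<in> Lp_loc p \<and> (\<exists>C. Bp_const p V C)}"

text \<open>Only sets over which \<open>V\<close> is integrable are tested: the Bochner integral of a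
  non-integrable function is \<open>0\<close> by convention, so without this guard no weight of infinite
  total mass (not even the constant identity matrix) would belong to the class. For locally
  integrable \<open>V\<close>, all bounded measurable sets are covered.\<close>

definition ND_class :: "(real^'n \<Rightarrow> real^'d^'d) set" where
  "ND_class = {V. matrix_weight V \<and>
     (\<forall>E \<in> sets lebesgue. 0 < emeasure lebesgue E \<and> set_integrable lebesgue E V \<longrightarrow>
        pd_matrix (weight_of V E))}"

definition Psi :: "real^'n \<Rightarrow> real \<Rightarrow> (real^'n \<Rightarrow> real^'d^'d) \<Rightarrow> real^'d^'d" where
  "Psi x r V = (r powr (2 - real CARD('n))) *\<^sub>R weight_of V (cube x r)"

text \<open>The infimum of the quadratic form over the compact unit sphere is its minimum. The set below
  is nonempty and bounded above for \<open>V\<close> in \<open>Bp_class p \<inter> ND_class\<close> with \<open>p > CARD('n) / 2\<close>,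
  so the real-valued supremum is the intended one, and it is positive.\<close>

definition lower_m :: "real^'n \<Rightarrow> (real^'n \<Rightarrow> real^'d^'d) \<Rightarrow> real" where
  "lower_m x V =
     1 / Sup {r. 0 < r \<and> (INF e\<in>sphere (0 :: real^'d) 1. (Psi x r V *v e) \<bullet> e) \<le> 1}"

definition NC_const :: "(real^'n \<Rightarrow> real^'d^'d) \<Rightarrow> real \<Rightarrow> bool" where
  "NC_const V N \<longleftrightarrow> 0 < N \<and>
     (\<forall>x e. let Q = cube x (1 / lower_m x V) in
        N * (norm e)\<^sup>2 \<le>
        (LINT y:Q|lebesgue.
           ((msqrt (V y) ** matrix_inv (weight_of V Q) ** msqrt (V y)) *v e) \<bullet> e))"

definition NC_class :: "(real^'n \<Rightarrow> real^'d^'d) set" where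
  "NC_class = {V. matrix_weight V \<and> (\<exists>N. NC_const V N)}"

definition C1_compact_support :: "(real^'n \<Rightarrow> real^'d) \<Rightarrow> bool" where
  "C1_compact_support u \<longleftrightarrow>
     (\<forall>x. u differentiable (at x)) \<and>
     continuous_on UNIV (\<lambda>x. jacobian u (at x)) \<and>
     compact (closure {x. u x \<noteq> 0})"

end

theory Submission
  imports Defs
begin

text \<open>
  Write \<open>\<rho>(x)\<close> for the reciprocal of the lower auxiliary function and \<open>Q\<^sub>x\<close> for the cube of centre \<open>x\<close>
  and half side \<open>\<rho>(x)\<close>, the critical cube at \<open>x\<close>. The inequality is proved on each critical cube, with
  a constant independent of the cube, and the local inequalities are then added over a family of
  critical cubes that covers the support of \<open>u\<close> and overlaps boundedly.

  For a fixed vector \<open>e\<close> the function \<open>\<langle>V e, e\<rangle>\<close> satisfies a scalar reverse Hoelder inequality.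
  Therefore the mass it gives to a subset \<open>E\<close> of a cube \<open>Q\<close> is at most a constant times
  \<open>(|E| / |Q|)\<^sup>1\<^sup>-\<^sup>1\<^sup>/\<^sup>p\<close> times the mass of \<open>Q\<close> (\<open>mass_subset_bound\<close>). This one estimate gives doubling, since
  a thin shell carries at most half of the mass, and, since \<open>p > n / 2\<close>, it gives the decay of
  \<open>\<langle>\<Psi>(x, r) e, e\<rangle>\<close> like \<open>r\<^sup>\<alpha>\<close>, \<open>\<alpha> = 2 - n / p > 0\<close>, as \<open>r\<close> shrinks. Decay and doubling together show that
  \<open>\<rho>\<close> is finite and positive, that \<open>\<Psi>(x, \<rho>(x))\<close> is bounded below as a form and bounded above in some
  direction, and that \<open>\<rho>\<close> varies by at most a constant factor on \<open>Q\<^sub>x\<close> (\<open>\<rho>_lower_on_cube\<close>,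
  \<open>\<rho>_upper_on_cube\<close>).

  On \<open>Q = Q\<^sub>x\<close> put \<open>A = V(Q)\<close>. Noncommutativity enters through the class \<open>NC\<close>: up to \<open>N\<close>, the number
  \<open>|u(y)|\<^sup>2\<close> is bounded by the integral over \<open>z \<in> Q\<close> of \<open>|A\<^sup>-\<^sup>1\<^sup>/\<^sup>2 V\<^sup>1\<^sup>/\<^sup>2(z) u(y)|\<^sup>2\<close>. Replacing \<open>u(y)\<close> by \<open>u(z)\<close>
  leaves a term controlled by \<open>|V\<^sup>1\<^sup>/\<^sup>2 u|\<^sup>2\<close>, because \<open>A \<ge> c \<rho>\<^sup>n\<^sup>-\<^sup>2\<close>, and an error
  \<open>w(z) |u(y) - u(z)|\<^sup>2\<close>, where \<open>w = tr (A\<^sup>-\<^sup>1 V)\<close> is a sum of \<open>d\<close> scalar densities of mass one on \<open>Q\<close>. The error is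
  absorbed by the gradient term through a weighted Poincare inequality (\<open>weighted_poincare\<close>), for which
  it is enough that \<open>w\<close> gives mass \<open>O(t\<^sup>n\<^sup>-\<^sup>2\<^sup>+\<^sup>\<alpha>)\<close> to subcubes of relative size \<open>t\<close>; this is
  \<open>mass_subset_bound\<close> again. The result is \<open>local_inequality\<close>, and the Vitali covering lemma applied to
  balls of radius \<open>\<rho>/5\<close> supplies the cover (\<open>critical_cubes_cover\<close>, \<open>finite_overlap\<close>).
\<close>

section \<open>Square roots of positive semidefinite matrices\<close>

lemma quadratic_nonpos_imp_linear_coeff_zero:
  fixes a b :: real
  assumes "\<And>t. 2 * t * a + t\<^sup>2 * b \<le> 0"
  shows "a = 0"
proof (rule ccontr)
  assume "a \<noteq> 0"
  define c where "c = \<bar>b\<bar> + 1"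
  have c: "c > 0" "b \<ge> - c" "c \<noteq> 0" by (auto simp: c_def)
  have "2 * (a / c) * a + (a / c)\<^sup>2 * b \<ge> 2 * (a / c) * a + (a / c)\<^sup>2 * (- c)"
    by (intro add_left_mono mult_left_mono c) auto
  moreover have "2 * (a / c) * a + (a / c)\<^sup>2 * (- c) = a\<^sup>2 / c"
    using c by (simp add: field_simps power2_eq_square)
  moreover have "a\<^sup>2 / c > 0" using c \<open>a \<noteq> 0\<close> by simp
  ultimately show False using assms[of "a / c"] by linarith
qed

text \<open>A maximiser \<open>v\<close> of the Rayleigh quotient is an eigenvector: perturbing \<open>v\<close> in the direction of the
  residual \<open>f v - l v\<close> changes the quotient to first order by the square of its norm.\<close>

lemma selfadjoint_has_eigenvector:
  fixes f :: "'a::euclidean_space \<Rightarrow> 'a"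
  assumes lin: "linear f" and sym: "\<And>x y. f x \<bullet> y = x \<bullet> f y"
    and W: "subspace W" "\<And>x. x \<in> W \<Longrightarrow> f x \<in> W" "W \<noteq> {0}"
  obtains v l where "v \<in> W" "norm v = 1" "f v = l *\<^sub>R v"
proof -
  interpret linear f by fact
  have cont: "continuous_on S f" for S
    by (intro linear_continuous_on linear_conv_bounded_linear[THEN iffD1] lin)
  have comp: "compact (sphere 0 1 \<inter> W)"
    by (intro compact_Int_closed closed_subspace W) auto
  obtain w where w: "w \<in> W" "w \<noteq> 0" using W subspace_0 by blast
  have "w /\<^sub>R norm w \<in> sphere 0 1 \<inter> W" using w W by (auto simp: subspace_scale)
  then have "sphere 0 1 \<inter> W \<noteq> {}" by blast
  moreover have "continuous_on (sphere 0 1 \<inter> W) (\<lambda>x. x \<bullet> f x)"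
    by (intro continuous_on_inner continuous_on_id cont)
  ultimately obtain v where v: "v \<in> sphere 0 1" "v \<in> W" and
    vmax: "\<And>y. y \<in> sphere 0 1 \<inter> W \<Longrightarrow> y \<bullet> f y \<le> v \<bullet> f v"
    using continuous_attains_sup[OF comp, of "\<lambda>x. x \<bullet> f x"] by (metis Int_iff)
  define l where "l = v \<bullet> f v"
  have le: "y \<bullet> f y \<le> l * (y \<bullet> y)" if "y \<in> W" for y
  proof (cases "y = 0")
    case False
    have "y /\<^sub>R norm y \<in> sphere 0 1 \<inter> W" using that False W by (auto simp: subspace_scale)
    from vmax[OF this] have "(y \<bullet> f y) / (norm y)\<^sup>2 \<le> l"
      by (simp add: scaleR l_def power2_eq_square divide_inverse mult_ac)
    then show ?thesis using False
      by (simp add: divide_simps power2_norm_eq_inner)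
  qed (simp add: zero)
  define w where "w = f v - l *\<^sub>R v"
  have wW: "w \<in> W" using v W by (auto simp: w_def subspace_diff subspace_scale)
  have vv: "v \<bullet> v = 1" using v by (simp add: dot_square_norm)
  have "2 * t * (w \<bullet> w) + t\<^sup>2 * (w \<bullet> f w - l * (w \<bullet> w)) \<le> 0" for t
  proof -
    have "v + t *\<^sub>R w \<in> W" using v wW W by (auto simp: subspace_add subspace_scale)
    from le[OF this] have "v \<bullet> f v + 2 * t * (f v \<bullet> w) + t\<^sup>2 * (w \<bullet> f w)
      \<le> l * (1 + 2 * t * (v \<bullet> w) + t\<^sup>2 * (w \<bullet> w))"
      by (simp add: add scaleR inner_simps vv sym[of v w, symmetric] inner_commute[of w v]
          inner_commute[of w "f v"] power2_eq_square algebra_simps)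
    moreover have "f v \<bullet> w = w \<bullet> w + l * (v \<bullet> w)"
      by (subst (2) w_def) (simp add: inner_simps)
    ultimately show ?thesis by (simp add: l_def[symmetric] algebra_simps)
  qed
  then have "w \<bullet> w = 0" by (rule quadratic_nonpos_imp_linear_coeff_zero)
  then have "f v = l *\<^sub>R v" by (simp add: w_def)
  then show ?thesis using v that by auto
qed

text \<open>Induction on the dimension, splitting off one eigenvector: its orthogonal complement in \<open>W\<close> is again
  invariant because \<open>f\<close> is self-adjoint.\<close>

lemma selfadjoint_orthonormal_eigenbasis:
  fixes f :: "'a::euclidean_space \<Rightarrow> 'a"
  assumes lin: "linear f" and sym: "\<And>x y. f x \<bullet> y = x \<bullet> f y"
    and "subspace W" "\<And>x. x \<in> W \<Longrightarrow> f x \<in> W"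
  shows "\<exists>B. finite B \<and> (\<forall>b\<in>B. norm b = 1 \<and> (\<exists>l. f b = l *\<^sub>R b)) \<and> pairwise orthogonal B \<and> span B = W"
  using assms(3,4)
proof (induction "dim W" arbitrary: W rule: less_induct)
  case less
  note W = less.prems
  show ?case
  proof (cases "W = {0}")
    case True
    then show ?thesis by (intro exI[of _ "{}"]) auto
  next
    case False
    obtain v l where v: "v \<in> W" "norm v = 1" "f v = l *\<^sub>R v"
      using selfadjoint_has_eigenvector[OF lin sym W False] by blast
    have vv: "v \<bullet> v = 1" using v by (simp add: dot_square_norm)
    define W' where "W' = {y \<in> W. v \<bullet> y = 0}"
    have sub: "subspace W'"
      using W by (auto simp: W'_def subspace_def inner_simps)
    have inv: "f x \<in> W'" if "x \<in> W'" for x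
      using that W sym[of v x] v by (auto simp: W'_def)
    have "v \<notin> W'" using vv by (auto simp: W'_def)
    then have "W' \<subset> W" using v(1) by (metis (no_types, lifting) W'_def mem_Collect_eq psubsetI subsetI)
    then have "dim W' < dim W"
      by (metis dim_psubset span_eq_iff sub W(1))
    from less.hyps[OF this sub inv] obtain B where B: "finite B"
      "\<forall>b\<in>B. norm b = 1 \<and> (\<exists>l. f b = l *\<^sub>R b)" "pairwise orthogonal B" "span B = W'" by blast
    have BW': "b \<in> W'" if "b \<in> B" for b using that B(4) span_base by blast
    have "span (insert v B) = W"
    proof
      show "span (insert v B) \<subseteq> W"
        using v BW' W(1) by (intro span_minimal) (auto simp: W'_def)
      show "W \<subseteq> span (insert v B)"
      proof
        fix y assume y: "y \<in> W"
        have "y - (v \<bullet> y) *\<^sub>R v \<in> W'"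
          using y v W(1) by (auto simp: W'_def inner_simps vv subspace_diff subspace_scale)
        then show "y \<in> span (insert v B)"
          using B(4) by (auto simp: span_insert)
      qed
    qed
    moreover have "pairwise orthogonal (insert v B)"
      using B(3) BW' by (auto simp: pairwise_insert orthogonal_def W'_def inner_commute)
    ultimately show ?thesis
      using B v by (intro exI[of _ "insert v B"]) auto
  qed
qed

lemma symmetric_matrix_inner:
  fixes A :: "real^'d^'d"
  assumes "transpose A = A"
  shows "(A *v x) \<bullet> y = x \<bullet> (A *v y)"
  by (metis assms dot_lmul_matrix transpose_matrix_vector)

lemma symmetric_matrix_eigenbasis:
  fixes A :: "real^'d^'d"
  assumes "transpose A = A"
  obtains B where "finite B" "\<forall>b\<in>B. norm b = 1"
    "\<forall>b\<in>B. \<exists>l. A *v b = l *\<^sub>R b" "pairwise orthogonal B" "span B = UNIV"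
proof -
  have "\<exists>B. finite B \<and> (\<forall>b\<in>B. norm b = 1 \<and> (\<exists>l. A *v b = l *\<^sub>R b)) \<and> pairwise orthogonal B \<and> span B = UNIV"
    by (rule selfadjoint_orthonormal_eigenbasis[OF matrix_vector_mul_linear symmetric_matrix_inner[OF assms]
          subspace_UNIV]) simp
  then show ?thesis using that by metis
qed

lemma psd_sqrt_exists:
  fixes A :: "real^'d^'d"
  assumes "psd_matrix A"
  shows "\<exists>S. psd_matrix S \<and> S ** S = A"
proof -
  have sym: "transpose A = A" and nn: "\<And>e. 0 \<le> (A *v e) \<bullet> e"
    using assms by (auto simp: psd_matrix_def)
  obtain B where B: "finite B" "\<forall>b\<in>B. norm b = 1"
    "\<forall>b\<in>B. \<exists>l. A *v b = l *\<^sub>R b" "pairwise orthogonal B" "span B = UNIV"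
    by (rule symmetric_matrix_eigenbasis[OF sym])
  define l where "l b = (A *v b) \<bullet> b" for b
  have l: "A *v b = l b *\<^sub>R b" "l b \<ge> 0" if "b \<in> B" for b
  proof -
    obtain c where c: "A *v b = c *\<^sub>R b" using B(3) \<open>b \<in> B\<close> by blast
    then have "l b = c" using bspec[OF B(2) \<open>b \<in> B\<close>] by (simp add: l_def dot_square_norm)
    then show "A *v b = l b *\<^sub>R b" using c by simp
    show "l b \<ge> 0" using nn by (simp add: l_def)
  qed
  have orth: "b \<bullet> c = (if b = c then 1 else 0)" if "b \<in> B" "c \<in> B" for b c
    using B(4) bspec[OF B(2) that(1)] that by (auto simp: pairwise_def orthogonal_def dot_square_norm)
  define s where "s x = (\<Sum>b\<in>B. (sqrt (l b) * (x \<bullet> b)) *\<^sub>R b)" for x :: "real^'d"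
  have lin: "linear s"
    by (rule linearI) (auto simp: s_def inner_simps algebra_simps sum.distrib scaleR_sum_right)
  have sb: "s b = sqrt (l b) *\<^sub>R b" if "b \<in> B" for b
  proof -
    have "s b = (\<Sum>c\<in>B. if c = b then sqrt (l b) *\<^sub>R b else 0)"
      unfolding s_def by (rule sum.cong) (auto simp: orth that)
    then show ?thesis using B(1) that by simp
  qed
  define S where "S = matrix s"
  have S: "S *v x = s x" for x by (simp add: S_def matrix_works lin)
  have inner_s: "s x \<bullet> y = (\<Sum>b\<in>B. sqrt (l b) * (x \<bullet> b) * (y \<bullet> b))" for x y
    unfolding s_def inner_sum_left by (rule sum.cong) (auto simp: inner_commute)
  have "transpose S = S"
  proof -
    have "(transpose S *v x) \<bullet> y = (S *v x) \<bullet> y" for x y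
    proof -
      have "(transpose S *v x) \<bullet> y = s y \<bullet> x"
        by (simp only: transpose_matrix_vector dot_lmul_matrix S) (rule inner_commute)
      also have "\<dots> = s x \<bullet> y"
        unfolding inner_s by (simp add: mult_ac)
      finally show ?thesis by (simp add: S)
    qed
    then have "\<forall>x. transpose S *v x = S *v x"
      by (metis vector_eq_rdot)
    then show ?thesis by (simp add: matrix_eq)
  qed
  moreover have "0 \<le> (S *v e) \<bullet> e" for e
    unfolding S inner_s by (intro sum_nonneg) (simp add: l mult.assoc)
  moreover have "S ** S = A"
  proof -
    have "s (s x) = A *v x" if "x \<in> span B" for x
    proof (rule linear_eq_on[OF _ _ that])
      show "linear (\<lambda>x. s (s x))" using linear_compose[OF lin lin] by (simp add: o_def)
      show "linear ((*v) A)" by (rule matrix_vector_mul_linear)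
      fix b assume "b \<in> B"
      then show "s (s b) = A *v b" by (simp add: sb l linear_scale[OF lin])
    qed
    then show ?thesis by (simp add: matrix_eq B S matrix_vector_mul_assoc[symmetric])
  qed
  ultimately show ?thesis by (auto simp: psd_matrix_def)
qed

text \<open>Any positive semidefinite root \<open>S\<close> of \<open>T\<^sup>2\<close> agrees with \<open>T\<close> on an eigenbasis of \<open>T\<close>, because an eigenvector of
  \<open>S\<^sup>2\<close> for the eigenvalue \<open>l\<^sup>2\<close>, \<open>l \<ge> 0\<close>, is an eigenvector of \<open>S\<close> for \<open>l\<close>.\<close>

lemma psd_sqrt_unique:
  fixes S T :: "real^'d^'d"
  assumes S: "psd_matrix S" and T: "psd_matrix T" and eq: "S ** S = T ** T"
  shows "S = T"
proof -
  have sym: "transpose T = T" and symS: "transpose S = S" using S T by (auto simp: psd_matrix_def)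
  have nn: "0 \<le> (T *v e) \<bullet> e"  "0 \<le> (S *v e) \<bullet> e" for e using S T by (auto simp: psd_matrix_def)
  obtain B where B: "finite B" "\<forall>b\<in>B. norm b = 1"
    "\<forall>b\<in>B. \<exists>l. T *v b = l *\<^sub>R b" "pairwise orthogonal B" "span B = UNIV"
    by (rule symmetric_matrix_eigenbasis[OF sym])
  have "S *v b = T *v b" if b: "b \<in> B" for b
  proof -
    obtain l where l: "T *v b = l *\<^sub>R b" using B(3) b by blast
    have "l \<ge> 0" using nn(1)[of b] bspec[OF B(2) b] by (simp add: l dot_square_norm)
    have SS: "S *v (S *v b) = l\<^sup>2 *\<^sub>R b"
      by (simp add: matrix_vector_mul_assoc eq) 
         (simp add: matrix_vector_mul_assoc[symmetric] l matrix_vector_mult_scaleR power2_eq_square)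
    show ?thesis
    proof (cases "l = 0")
      case True
      have "(S *v b) \<bullet> (S *v b) = b \<bullet> (S *v (S *v b))"
        by (rule symmetric_matrix_inner[OF symS])
      then show ?thesis using SS True l by simp
    next
      case False
      \<comment> \<open>\<open>(S + l)(S - l) b = 0\<close> and \<open>S + l\<close> is positive definite\<close>
      define w where "w = S *v b - l *\<^sub>R b"
      have "S *v w + l *\<^sub>R w = 0"
        by (simp add: w_def matrix_vector_mult_diff_distrib SS matrix_vector_mult_scaleR power2_eq_square algebra_simps)
      then have "(S *v w) \<bullet> w + l * (w \<bullet> w) = 0"
        by (metis inner_add_left inner_scaleR_left inner_zero_left)
      moreover have "l * (w \<bullet> w) \<ge> 0" using \<open>l \<ge> 0\<close> by simp
      ultimately have "l * (w \<bullet> w) = 0" using nn(2)[of w] by linarith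
      then show ?thesis using False l by (simp add: w_def)
    qed
  qed
  then have "S *v x = T *v x" if "x \<in> span B" for x
    using linear_eq_on[OF matrix_vector_mul_linear matrix_vector_mul_linear that] by blast
  then show ?thesis by (simp add: B matrix_eq)
qed

lemma msqrt:
  fixes A :: "real^'d^'d"
  assumes "psd_matrix A"
  shows psd_msqrt: "psd_matrix (msqrt A)" and msqrt_square: "msqrt A ** msqrt A = A"
proof -
  have "\<exists>!S. psd_matrix S \<and> S ** S = A"
    using psd_sqrt_exists[OF assms] psd_sqrt_unique by blast
  from theI'[OF this] show "psd_matrix (msqrt A)" "msqrt A ** msqrt A = A"
    by (simp_all add: msqrt_def)
qed

lemma norm_msqrt_squared:
  assumes "psd_matrix A"
  shows "(norm (msqrt A *v v))\<^sup>2 = (A *v v) \<bullet> v"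
proof -
  have "transpose (msqrt A) = msqrt A" using psd_msqrt[OF assms] by (simp add: psd_matrix_def)
  then have "(norm (msqrt A *v v))\<^sup>2 = v \<bullet> (msqrt A *v (msqrt A *v v))"
    by (simp add: power2_norm_eq_inner symmetric_matrix_inner)
  then show ?thesis by (simp add: matrix_vector_mul_assoc msqrt_square[OF assms] inner_commute)
qed

section \<open>Reverse Hoelder bounds on cubes and doubling\<close>

lemma mem_cube: "y \<in> cube x r \<longleftrightarrow> (\<forall>i. \<bar>y $ i - x $ i\<bar> \<le> r)"
  by (auto simp: cube_def mem_box_cart abs_le_iff algebra_simps)

lemma cube_mono: "r \<le> s \<Longrightarrow> cube x r \<subseteq> cube x s"
  unfolding mem_cube subset_iff by (meson order_trans)

lemma compact_cube: "compact (cube x r)"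
  by (simp add: cube_def)

lemma sets_cube[measurable]: "cube x r \<in> sets lebesgue" "cube x r \<in> sets borel"
  by (simp_all add: cube_def)

lemma cube_lmeasurable: "cube x r \<in> lmeasurable"
  by (simp add: cube_def)

lemma measure_cube:
  fixes x :: "real^'n"
  assumes "0 \<le> r"
  shows "measure lebesgue (cube x r) = (2 * r) ^ CARD('n)" "measure lborel (cube x r) = (2 * r) ^ CARD('n)"
proof -
  have "x \<in> cube x r" using assms by (simp add: mem_cube)
  then have "cube x r \<noteq> {}" by blast
  then show "measure lborel (cube x r) = (2 * r) ^ CARD('n)" by (simp add: cube_def content_cbox_cart)
  then show "measure lebesgue (cube x r) = (2 * r) ^ CARD('n)" by simp
qed

text \<open>The scalar measure of density \<open>\<langle>V e, e\<rangle>\<close>, which is what the \<open>B\<^sub>p\<close> condition controls.\<close>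

abbreviation mass :: "(real^'n \<Rightarrow> real^'d^'d) \<Rightarrow> real^'d \<Rightarrow> (real^'n) set \<Rightarrow> real" where
  "mass V e E \<equiv> (weight_of V E *v e) \<bullet> e"

lemma linear_quadratic_form: "bounded_linear (\<lambda>A :: real^'d^'d. (A *v e) \<bullet> e)"
proof -
  have "linear (\<lambda>A :: real^'d^'d. (A *v e) \<bullet> e)"
    by (rule linearI) (simp_all add: matrix_vector_mult_add_rdistrib inner_simps scaleR_matrix_vector_assoc[symmetric])
  then show ?thesis by (simp add: linear_conv_bounded_linear)
qed

lemma
  assumes "set_integrable lebesgue E V"
  shows mass_eq: "mass V e E = (LINT z:E|lebesgue. (V z *v e) \<bullet> e)"
    and set_integrable_quadratic_form: "set_integrable lebesgue E (\<lambda>z. (V z *v e) \<bullet> e)"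
proof -
  interpret bounded_linear "\<lambda>A. (A *v e) \<bullet> e" by (rule linear_quadratic_form)
  have i: "integrable lebesgue (\<lambda>z. indicator E z *\<^sub>R V z)"
    using assms by (simp add: set_integrable_def)
  show "mass V e E = (LINT z:E|lebesgue. (V z *v e) \<bullet> e)"
    using integral_bounded_linear[OF linear_quadratic_form[of e] i]
    by (simp add: weight_of_def set_lebesgue_integral_def scaleR)
  show "set_integrable lebesgue E (\<lambda>z. (V z *v e) \<bullet> e)"
    using integrable_bounded_linear[OF linear_quadratic_form[of e] i]
    by (simp add: set_integrable_def scaleR)
qed

locale Bp_class_weight =
  fixes p :: real and V :: "real^'n \<Rightarrow> real^'d^'d"
  assumes p: "1 < p" and V: "V \<in> Bp_class p"
begin

lemma V_meas[measurable]: "V \<in> borel_measurable lebesgue"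
  and V_psd: "psd_matrix (V z)"
  using V by (auto simp: Bp_class_def matrix_weight_def)

lemma V_nonneg: "0 \<le> (V z *v e) \<bullet> e"
  using V_psd[of z] by (simp add: psd_matrix_def)

lemma V_powr_integrable: "compact K \<Longrightarrow> set_integrable lebesgue K (\<lambda>z. norm (V z) powr p)"
  using V by (auto simp: Bp_class_def Lp_loc_def)

lemma V_integrable_cube: "set_integrable lebesgue (cube x r) V"
proof -
  have "set_integrable lebesgue (cube x r) (\<lambda>z. 1 + norm (V z) powr p)"
    by (intro set_integral_add V_powr_integrable compact_cube)
      (use cube_lmeasurable[of x r] in \<open>auto simp: set_integrable_def fmeasurable_def\<close>)
  then show ?thesis
  proof (rule set_integrable_bound)
    show "set_borel_measurable lebesgue (cube x r) V"
      unfolding set_borel_measurable_def by measurable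
    have "t \<le> 1 + t powr p" if "0 \<le> t" for t :: real
    proof (cases "t \<le> 1")
      case False
      then have "t powr 1 \<le> t powr p" using p by (intro powr_mono) auto
      then show ?thesis using False by simp
    next
      case True
      have "0 \<le> t powr p" by simp
      then show ?thesis using True by linarith
    qed
    then show "AE z in lebesgue. z \<in> cube x r \<longrightarrow> norm (V z) \<le> norm (1 + norm (V z) powr p)"
      by (auto intro!: AE_I2 order_trans[OF _ abs_ge_self])
  qed
qed

lemma V_integrable:
  assumes "E \<subseteq> cube x r" "E \<in> sets lebesgue"
  shows "set_integrable lebesgue E V"
  using set_integrable_subset[OF V_integrable_cube assms(2,1)] .

lemma mass_mono:
  assumes "E \<subseteq> F" "F \<subseteq> cube x r" "E \<in> sets lebesgue" "F \<in> sets lebesgue"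
  shows "mass V e E \<le> mass V e F"
proof -
  have "set_integrable lebesgue E V" "set_integrable lebesgue F V"
    using assms by (auto intro!: V_integrable)
  note * = this set_integrable_quadratic_form[OF this(1)] set_integrable_quadratic_form[OF this(2)]
  show ?thesis
    unfolding mass_eq[OF *(1)] mass_eq[OF *(2)] set_lebesgue_integral_def
    using *(3,4) assms(1) V_nonneg
    by (intro integral_mono) (auto simp: set_integrable_def indicator_def)
qed

lemma mass_nonneg:
  assumes "E \<subseteq> cube x r" "E \<in> sets lebesgue"
  shows "0 \<le> mass V e E"
  unfolding mass_eq[OF V_integrable[OF assms]] set_lebesgue_integral_def
  by (intro integral_nonneg_AE) (auto simp: V_nonneg)

lemma mass_Diff:
  assumes "E \<subseteq> F" "F \<subseteq> cube x r" "E \<in> sets lebesgue" "F \<in> sets lebesgue"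
  shows "mass V e (F - E) = mass V e F - mass V e E"
proof -
  have "weight_of V (E \<union> (F - E)) = weight_of V E + weight_of V (F - E)"
    unfolding weight_of_def using assms
    by (intro set_integral_Un V_integrable[of _ x r]) auto
  moreover have "E \<union> (F - E) = F" using assms by auto
  ultimately show ?thesis
    by (simp add: matrix_vector_mult_add_rdistrib inner_simps)
qed

lemma quad_powr_integrable: "set_integrable lebesgue (cube x r) (\<lambda>z. ((V z *v e) \<bullet> e) powr p)"
proof -
  obtain K where K: "\<And>A :: real^'d^'d. norm ((A *v e) \<bullet> e) \<le> norm A * K" "K \<ge> 0"
    using bounded_linear.nonneg_bounded[OF linear_quadratic_form[of e]] by blast
  have "set_integrable lebesgue (cube x r) (\<lambda>z. K powr p * norm (V z) powr p)"
    by (intro set_integrable_mult_right V_powr_integrable compact_cube) 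
  then show ?thesis
  proof (rule set_integrable_bound)
    have "(\<lambda>z. (V z *v e) \<bullet> e) \<in> borel_measurable lebesgue"
      by (rule measurable_compose[OF V_meas])
        (intro borel_measurable_continuous_onI linear_continuous_on linear_quadratic_form)
    then show "set_borel_measurable lebesgue (cube x r) (\<lambda>z. ((V z *v e) \<bullet> e) powr p)"
      unfolding set_borel_measurable_def by measurable
    have "((V z *v e) \<bullet> e) powr p \<le> K powr p * norm (V z) powr p" for z
    proof -
      have "((V z *v e) \<bullet> e) powr p \<le> (norm (V z) * K) powr p"
        using K(1)[of "V z"] V_nonneg[of z e] p by (intro powr_mono2) auto
      then show ?thesis using K(2) by (simp add: powr_mult mult.commute)
    qed
    then show "AE z in lebesgue. z \<in> cube x r \<longrightarrow>
        norm (((V z *v e) \<bullet> e) powr p) \<le> norm (K powr p * norm (V z) powr p)"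
      by (auto intro!: AE_I2)
  qed
qed

end

locale Bp_weight = Bp_class_weight p V for p C :: real and V :: "real^'n \<Rightarrow> real^'d^'d" +
  assumes C: "1 \<le> C" and Bp: "Bp_const p V C"
begin

text \<open>This is Hoelder's inequality for the indicator of \<open>E\<close> followed by the \<open>B\<^sub>p\<close> condition. Instead of
  Hoelder, the proof integrates the pointwise bound \<open>f \<le> l + f\<^sup>p l\<^sup>1\<^sup>-\<^sup>p\<close> and optimises in \<open>l\<close>, which costs the
  factor 2.\<close>

lemma mass_subset_bound:
  assumes r: "0 < r" and E: "E \<subseteq> cube x r" "E \<in> sets lebesgue"
  shows "mass V e E \<le> 2 * C * (measure lebesgue E / measure lebesgue (cube x r)) powr (1 - 1 / p)
           * mass V e (cube x r)"
proof -
  define f where "f z = (V z *v e) \<bullet> e" for z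
  define Q where "Q = cube x r"
  define a where "a = measure lebesgue E"
  define q where "q = measure lebesgue Q"
  define M where "M = mass V e Q"
  define F where "F = (LINT z:Q|lebesgue. f z powr p)"
  define G where "G = C * (M / q)"
  have f0: "f z \<ge> 0" for z by (simp add: f_def V_nonneg)
  have q: "q > 0" using r by (simp add: q_def Q_def measure_cube)
  have M0: "M \<ge> 0" unfolding M_def Q_def by (rule mass_nonneg) auto
  have fE: "set_integrable lebesgue E f"
    unfolding f_def by (intro set_integrable_quadratic_form V_integrable[OF E])
  have fp: "set_integrable lebesgue Q (\<lambda>z. f z powr p)"
    unfolding f_def Q_def by (rule quad_powr_integrable)
  have Elm: "E \<in> lmeasurable" using E cube_lmeasurable by (rule fmeasurableI2[rotated 1])
  have goal: "mass V e E \<le> 2 * G * q powr (1 / p) * a powr (1 - 1 / p)"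
  proof (cases "a = 0 \<or> G = 0")
    case True
    then show ?thesis
    proof
      assume "a = 0"
      then have "E \<in> null_sets lebesgue"
        using Elm by (auto simp: a_def measure_eq_0_null_sets intro!: null_setsI simp: emeasure_eq_measure2)
      then have "weight_of V E = 0"
        unfolding weight_of_def set_lebesgue_integral_def
        by (intro integral_eq_zero_AE) (auto dest!: AE_not_in elim!: eventually_mono)
      then show ?thesis using \<open>a = 0\<close> by simp
    next
      assume "G = 0"
      then have "M = 0" using C q by (simp add: G_def)
      then show ?thesis
        using mass_mono[OF E(1) order_refl E(2) sets_cube(1), of e] \<open>G = 0\<close> by (simp add: M_def Q_def)
    qed
  next
    case False
    have a: "a > 0" using False by (simp add: a_def zero_less_measure_iff)
    have G: "G > 0" using False C q M0 by (auto simp: G_def less_le)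
    \<comment> \<open>the solution of \<open>l a = l\<^sup>1\<^sup>-\<^sup>p q G\<^sup>p\<close>, which balances the bounds for the two terms\<close>
    define l where "l = G * (q / a) powr (1 / p)"
    have l: "l > 0" using G q a by (simp add: l_def)
    have F: "F \<le> q * G powr p"
    proof -
      have "(1 / q * F) powr (1 / p) \<le> C * (((1 / q) *\<^sub>R weight_of V Q *v e) \<bullet> e)"
        using Bp r unfolding Bp_const_def q_def Q_def F_def f_def by blast
      also have "\<dots> = G" by (simp add: G_def M_def scaleR_matrix_vector_assoc[symmetric])
      finally have "((1 / q * F) powr (1 / p)) powr p \<le> G powr p" using p by (intro powr_mono2) auto
      moreover have "F \<ge> 0"
        unfolding F_def set_lebesgue_integral_def by (intro integral_nonneg_AE) auto
      ultimately show ?thesis using q p by (simp add: powr_powr field_simps)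
    qed
    have fpE: "set_integrable lebesgue E (\<lambda>z. f z powr p)"
      using set_integrable_subset[OF fp E(2)] E(1) by (simp add: Q_def)
    have "f z \<le> l + l powr (1 - p) * f z powr p" for z
    proof (cases "f z \<le> l")
      case True
      have "0 \<le> l powr (1 - p) * f z powr p" by simp
      then show ?thesis using True by linarith
    next
      case False
      have "f z = f z powr (1 - p) * f z powr p"
        using False l by (simp add: powr_add[symmetric])
      also have "\<dots> \<le> l powr (1 - p) * f z powr p"
        using False l p by (intro mult_right_mono powr_mono2') auto
      finally show ?thesis using l by linarith
    qed
    moreover have il: "set_integrable lebesgue E (\<lambda>z. l + l powr (1 - p) * f z powr p)"
      using Elm by (intro set_integral_add set_integrable_mult_right fpE)
        (auto simp: set_integrable_def fmeasurable_def)
    ultimately have "mass V e E \<le> (LINT z:E|lebesgue. l + l powr (1 - p) * f z powr p)"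
      unfolding mass_eq[OF V_integrable[OF E]] f_def[symmetric]
      by (intro set_integral_mono fE) auto
    also have "\<dots> = l * a + l powr (1 - p) * (LINT z:E|lebesgue. f z powr p)"
    proof -
      have "set_integrable lebesgue E (\<lambda>z. l)"
        using Elm by (auto simp: set_integrable_def fmeasurable_def)
      moreover have "(LINT z:E|lebesgue. l) = l * a"
        using Elm by (simp add: set_lebesgue_integral_def a_def fmeasurable_def)
      ultimately show ?thesis
        by (simp add: set_integral_add set_integrable_mult_right fpE)
    qed
    also have "\<dots> \<le> l * a + l powr (1 - p) * F"
    proof -
      have "(LINT z:E|lebesgue. f z powr p) \<le> F"
        unfolding F_def set_lebesgue_integral_def
        using fpE fp E(1) by (intro integral_mono) (auto simp: set_integrable_def indicator_def Q_def)
      then show ?thesis by (intro add_left_mono mult_left_mono) auto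
    qed
    also have "\<dots> \<le> l * a + l powr (1 - p) * (q * G powr p)"
      using F by (intro add_left_mono mult_left_mono) auto
    also have "\<dots> = 2 * G * q powr (1 / p) * a powr (1 - 1 / p)"
    proof -
      have 1: "l * a = G * q powr (1 / p) * a powr (1 - 1 / p)"
        using a q by (simp add: l_def powr_divide powr_diff)
      have "l powr (1 - p) = G powr (1 - p) * (q / a) powr (1 / p - 1)"
        using G p q a by (simp add: l_def powr_mult powr_powr diff_divide_distrib)
      then have "l powr (1 - p) * (q * G powr p) = (G powr (1 - p) * G powr p) * (q * (q / a) powr (1 / p - 1))"
        by simp
      also have "G powr (1 - p) * G powr p = G" using G by (simp add: powr_add[symmetric])
      also have "q * (q / a) powr (1 / p - 1) = q powr (1 / p) * a powr (1 - 1 / p)"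
        using a q by (simp add: powr_divide powr_diff)
      finally show ?thesis using 1 by simp
    qed
    finally show ?thesis .
  qed
  have "2 * G * q powr (1 / p) * a powr (1 - 1 / p) = 2 * C * (a / q) powr (1 - 1 / p) * M"
    using q measure_nonneg[of lebesgue E] unfolding a_def[symmetric]
    by (simp add: G_def powr_divide powr_diff)
  then show ?thesis using goal by (simp add: a_def q_def Q_def M_def)
qed

lemma mass_cube_decay:
  assumes "0 < r" "r \<le> R"
  shows "mass V e (cube x r) \<le> 2 * C * (r / R) powr (real CARD('n) * (1 - 1 / p)) * mass V e (cube x R)"
proof -
  have "(2 * r) ^ CARD('n) / (2 * R) ^ CARD('n) = (r / R) powr real CARD('n)"
    using assms by (simp add: powr_realpow power_divide)
  then show ?thesis
    using mass_subset_bound[of R "cube x r" x e] assms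
    by (simp add: cube_mono measure_cube powr_powr)
qed

text \<open>For \<open>\<theta>\<close> close to 1 the shell between the two cubes is so thin that it carries at most half of the mass.\<close>

lemma mass_cube_dilate:
  assumes \<theta>: "0 < \<theta>" "\<theta> < 1" and small: "2 * C * (1 - \<theta> ^ CARD('n)) powr (1 - 1 / p) \<le> 1 / 2"
    and r: "0 < r"
  shows "mass V e (cube x r) \<le> 2 * mass V e (cube x (\<theta> * r))"
proof -
  let ?Q = "cube x r" and ?Q' = "cube x (\<theta> * r)"
  have sub: "?Q' \<subseteq> ?Q" using \<theta> r by (intro cube_mono) auto
  have "measure lebesgue (?Q - ?Q') = measure lebesgue ?Q - measure lebesgue ?Q'"
    by (intro measurable_measure_Diff cube_lmeasurable sub) auto
  also have "\<dots> / measure lebesgue ?Q = 1 - \<theta> ^ CARD('n)"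
    using \<theta> r by (simp add: measure_cube power_mult_distrib diff_divide_distrib)
  finally have "mass V e (?Q - ?Q') \<le> 2 * C * (1 - \<theta> ^ CARD('n)) powr (1 - 1 / p) * mass V e ?Q"
    using mass_subset_bound[OF r, of "?Q - ?Q'" x e] by (simp add: sets.Diff)
  also have "\<dots> \<le> 1 / 2 * mass V e ?Q"
    by (intro mult_right_mono small mass_nonneg[of _ x r]) auto
  finally show ?thesis using mass_Diff[OF sub order_refl, of e] by simp
qed

lemma mass_cube_doubling:
  assumes \<theta>: "0 < \<theta>" "\<theta> < 1" and small: "2 * C * (1 - \<theta> ^ CARD('n)) powr (1 - 1 / p) \<le> 1 / 2"
    and k: "\<theta> ^ k \<le> 1 / 2" and r: "0 < r"
  shows "mass V e (cube x (2 * r)) \<le> 2 ^ k * mass V e (cube x r)"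
proof -
  have "mass V e (cube x (2 * r)) \<le> 2 ^ j * mass V e (cube x (\<theta> ^ j * (2 * r)))" for j
  proof (induction j)
    case (Suc j)
    let ?s = "\<theta> ^ j * (2 * r)"
    have "mass V e (cube x ?s) \<le> 2 * mass V e (cube x (\<theta> * ?s))"
      using \<theta> r by (intro mass_cube_dilate[OF \<theta> small]) auto
    then have "2 ^ j * mass V e (cube x ?s) \<le> 2 ^ j * (2 * mass V e (cube x (\<theta> * ?s)))"
      by (intro mult_left_mono) auto
    with Suc have "mass V e (cube x (2 * r)) \<le> 2 ^ j * (2 * mass V e (cube x (\<theta> * ?s)))"
      by (rule order_trans)
    moreover have "\<theta> * ?s = \<theta> ^ Suc j * (2 * r)" by simp
    ultimately show ?case by (metis mult.assoc power_Suc2)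
  qed simp
  from this[of k] have "mass V e (cube x (2 * r)) \<le> 2 ^ k * mass V e (cube x (\<theta> ^ k * (2 * r)))" .
  also have "\<dots> \<le> 2 ^ k * mass V e (cube x r)"
  proof (intro mult_left_mono mass_mono[of _ _ x r] cube_mono)
    have "\<theta> ^ k * (2 * r) \<le> 1 / 2 * (2 * r)" using k r by (intro mult_right_mono) auto
    then show "\<theta> ^ k * (2 * r) \<le> r" by simp
  qed auto
  finally show ?thesis .
qed

end

text \<open>The doubling constant depends on \<open>n\<close>, \<open>p\<close> and \<open>C\<close> only; in particular one value serves all weights.\<close>

lemma doubling_constant_exists:
  fixes p C :: real
  assumes "1 < p" "1 \<le> C"
  obtains D where "1 \<le> D" "\<And>(V :: real^'n \<Rightarrow> real^'d^'d) e x r. Bp_weight p C V \<Longrightarrow> 0 < r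
      \<Longrightarrow> mass V e (cube x (2 * r)) \<le> D * mass V e (cube x r)"
proof -
  \<comment> \<open>the relative volume of a shell for which \<open>2 C \<epsilon>\<^sup>1\<^sup>-\<^sup>1\<^sup>/\<^sup>p = 1/2\<close>\<close>
  define \<epsilon> where "\<epsilon> = (4 * C) powr (- p / (p - 1))"
  have \<epsilon>: "0 < \<epsilon>" "\<epsilon> < 1"
    using assms by (auto simp: \<epsilon>_def intro!: powr_less_one)
  define \<theta> where "\<theta> = (1 - \<epsilon>) powr (1 / CARD('n))"
  have \<theta>: "0 < \<theta>" "\<theta> < 1" 
    using \<epsilon> powr_less_mono2[of "1 / CARD('n)" "1 - \<epsilon>" 1] by (auto simp: \<theta>_def)
  have "\<theta> ^ CARD('n) = 1 - \<epsilon>"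
    using \<theta> \<epsilon> by (simp add: powr_realpow[symmetric] \<theta>_def powr_powr)
  moreover have "\<epsilon> powr (1 - 1 / p) = 1 / (4 * C)"
  proof -
    have "- p / (p - 1) * (1 - 1 / p) = -1" using assms by (simp add: field_simps)
    then have "\<epsilon> powr (1 - 1 / p) = (4 * C) powr - 1" by (simp only: \<epsilon>_def powr_powr)
    then show ?thesis using assms by (simp add: powr_minus_divide)
  qed
  ultimately have small: "2 * C * (1 - \<theta> ^ CARD('n)) powr (1 - 1 / p) \<le> 1 / 2"
    using assms by simp
  obtain k where k: "\<theta> ^ k < 1 / 2" using real_arch_pow_inv[of "1/2" \<theta>] \<theta> by auto
  show ?thesis
    by (rule that[of "2 ^ k"])
      (auto intro: Bp_weight.mass_cube_doubling[OF _ \<theta> small less_imp_le[OF k]])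
qed

section \<open>The critical radius\<close>

text \<open>The doubling constant is a parameter, so that the constants below are expressions in \<open>p\<close>, \<open>C\<close>, \<open>D\<close> and
  the dimensions, and therefore the same for all weights that share them.\<close>

locale doubling_weight = Bp_weight p C V
  for p C :: real and V :: "real^'n \<Rightarrow> real^'d^'d" +
  fixes D :: real
  assumes n: "3 \<le> CARD('n)" and p_gt: "real CARD('n) / 2 < p" and D: "1 \<le> D"
    and ND: "V \<in> ND_class"
    and doubling: "0 < r \<Longrightarrow> mass V e (cube x (2 * r)) \<le> D * mass V e (cube x r)"
begin

definition \<alpha> :: real where "\<alpha> = 2 - real CARD('n) / p"

lemma \<alpha>: "0 < \<alpha>" "\<alpha> < 2"
  using p_gt p n by (auto simp: \<alpha>_def field_simps)

abbreviation \<psi> :: "real^'n \<Rightarrow> real \<Rightarrow> real^'d \<Rightarrow> real" where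
  "\<psi> x r e \<equiv> (Psi x r V *v e) \<bullet> e"

lemma \<psi>_eq: "\<psi> x r e = r powr (2 - real CARD('n)) * mass V e (cube x r)"
  by (simp add: Psi_def scaleR_matrix_vector_assoc[symmetric])

lemma mass_eq_\<psi>: "0 < r \<Longrightarrow> mass V e (cube x r) = r powr (real CARD('n) - 2) * \<psi> x r e"
  by (simp add: \<psi>_eq mult.assoc[symmetric] powr_add[symmetric])

lemma mass_cube_nonneg: "0 \<le> mass V e (cube x r)"
  by (rule mass_nonneg[of _ x r]) auto

lemma \<psi>_nonneg: "0 \<le> \<psi> x r e"
  unfolding \<psi>_eq by (intro mult_nonneg_nonneg mass_cube_nonneg) auto

text \<open>The factor \<open>r\<^sup>2\<^sup>-\<^sup>n\<close> in \<open>\<Psi>\<close> leaves the exponent \<open>n (1 - 1/p) + 2 - n = \<alpha>\<close>, which is positive exactly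
  when \<open>p > n/2\<close>.\<close>

lemma \<psi>_decay:
  assumes "0 < r" "r \<le> R"
  shows "\<psi> x r e \<le> 2 * C * (r / R) powr \<alpha> * \<psi> x R e"
proof -
  let ?n = "real CARD('n)"
  have "\<psi> x r e \<le> r powr (2 - ?n) * (2 * C * (r / R) powr (?n * (1 - 1 / p)) * mass V e (cube x R))"
    unfolding \<psi>_eq by (intro mult_left_mono mass_cube_decay assms) auto
  also have "\<dots> = 2 * C * (r powr (2 - ?n) * R powr (?n - 2) * (r / R) powr (?n * (1 - 1 / p))) * \<psi> x R e"
    using assms by (simp add: mass_eq_\<psi>)
  also have "r powr (2 - ?n) * R powr (?n - 2) = (r / R) powr (2 - ?n)"
    using assms by (simp add: powr_divide powr_diff)
  also have "(r / R) powr (2 - ?n) * (r / R) powr (?n * (1 - 1 / p)) = (r / R) powr \<alpha>"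
    by (simp add: powr_add[symmetric] \<alpha>_def algebra_simps)
  finally show ?thesis .
qed

definition admissible_radii :: "real^'n \<Rightarrow> real set" where
  "admissible_radii x = {r. 0 < r \<and> (INF e\<in>sphere (0 :: real^'d) 1. \<psi> x r e) \<le> 1}"

definition \<rho> :: "real^'n \<Rightarrow> real" where
  "\<rho> x = Sup (admissible_radii x)"

lemma lower_m_eq: "lower_m x V = 1 / \<rho> x"
  by (simp add: lower_m_def \<rho>_def admissible_radii_def)

lemma bdd_below_\<psi>: "bdd_below ((\<lambda>e. \<psi> x r e) ` S)"
  using \<psi>_nonneg by (intro bdd_belowI2[of _ 0]) auto

lemma admissibleI:
  assumes "0 < r" "norm e = 1" "\<psi> x r e \<le> 1"
  shows "r \<in> admissible_radii x"
  using cINF_lower2[OF bdd_below_\<psi> _ assms(3), of "sphere 0 1"] assms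
  by (simp add: admissible_radii_def)

lemma admissibleE:
  assumes "r \<in> admissible_radii x"
  obtains e where "norm e = 1" "\<psi> x r e \<le> 2"
proof -
  have "axis undefined 1 \<in> sphere (0 :: real^'d) 1" by (simp add: norm_axis_1)
  then have "sphere (0 :: real^'d) 1 \<noteq> {}" by blast
  moreover have "(INF e\<in>sphere 0 1. \<psi> x r e) < 2" using assms by (simp add: admissible_radii_def)
  ultimately show ?thesis
    using that by (subst (asm) cINF_less_iff[OF _ bdd_below_\<psi>]) force+
qed

lemma admissible_nonempty: "admissible_radii x \<noteq> {}"
proof -
  define e where "e = (axis undefined 1 :: real^'d)"
  \<comment> \<open>with \<open>r\<^sup>\<alpha> = 1 / b\<close> the decay estimate at \<open>r\<close> has right-hand side \<open>(b - 1) / b\<close>\<close>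
  define b where "b = 2 * C * \<psi> x 1 e + 1"
  have b: "b \<ge> 1" using C \<psi>_nonneg by (simp add: b_def)
  define r where "r = (1 / b) powr (1 / \<alpha>)"
  have r: "0 < r" "r \<le> 1" using b \<alpha> by (auto simp: r_def intro!: powr_le1)
  have "r powr \<alpha> = 1 / b" using b \<alpha> by (simp add: r_def powr_powr)
  then have "\<psi> x r e \<le> (b - 1) / b"
    using \<psi>_decay[OF r, of x e] by (simp add: b_def)
  also have "\<dots> \<le> 1" using b by simp
  finally have "r \<in> admissible_radii x"
    using r by (intro admissibleI) (auto simp: e_def norm_axis_1)
  then show ?thesis by blast
qed

lemma pd_weight_of_cube:
  assumes "0 < r"
  shows "pd_matrix (weight_of V (cube x r))"
proof -
  have "emeasure lebesgue (cube x r) = ennreal (measure lebesgue (cube x r))"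
    using cube_lmeasurable by (rule emeasure_eq_measure2)
  also have "\<dots> > 0" using assms by (subst measure_cube) auto
  finally show ?thesis
    using ND V_integrable_cube by (auto simp: ND_class_def)
qed

text \<open>Compactness of the sphere makes the positive definiteness of \<open>V(Q)\<close> uniform in the direction. The bound
  may depend on the weight: it only serves to see that the critical radius is finite.\<close>

lemma mass_unit_cube_lower_bound:
  obtains l where "0 < l" "\<And>e. norm e = 1 \<Longrightarrow> l \<le> mass V e (cube x 1)"
proof -
  have "pd_matrix (weight_of V (cube x 1))" by (rule pd_weight_of_cube) simp
  then have pos: "0 < mass V e (cube x 1)" if "norm e = 1" for e
  proof -
    have "e \<noteq> 0" using that by auto
    then show ?thesis using \<open>pd_matrix _\<close> by (simp add: pd_matrix_def)
  qed
  have "axis undefined 1 \<in> sphere (0 :: real^'d) 1" by (simp add: norm_axis_1)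
  then have "sphere (0 :: real^'d) 1 \<noteq> {}" by blast
  moreover have "continuous_on (sphere 0 1) (\<lambda>e. mass V e (cube x 1))"
    by (intro continuous_on_inner continuous_on_id linear_continuous_on matrix_vector_mul_bounded_linear)
  ultimately obtain e0 where "e0 \<in> sphere 0 1"
    "\<forall>e\<in>sphere 0 1. mass V e0 (cube x 1) \<le> mass V e (cube x 1)"
    using continuous_attains_inf[OF compact_sphere, of 0 1 "\<lambda>e. mass V e (cube x 1)"] by auto
  then show ?thesis using pos by (intro that[of "mass V e0 (cube x 1)"]) auto
qed

lemma admissible_bdd_above: "bdd_above (admissible_radii x)"
proof -
  obtain l where l: "0 < l" "\<And>e. norm e = 1 \<Longrightarrow> l \<le> mass V e (cube x 1)"
    using mass_unit_cube_lower_bound by blast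
  define M where "M = max 1 ((4 * C / l) powr (1 / \<alpha>))"
  have "r \<le> M" if r: "r \<in> admissible_radii x" for r
  proof (cases "r \<le> 1")
    case False
    obtain e where e: "norm e = 1" "\<psi> x r e \<le> 2" using r by (rule admissibleE)
    have "l \<le> \<psi> x 1 e" using l(2)[OF e(1)] by (simp add: \<psi>_eq)
    also have "\<dots> \<le> 2 * C * (1 / r) powr \<alpha> * \<psi> x r e" using False by (intro \<psi>_decay) auto
    also have "\<dots> \<le> 2 * C * (1 / r) powr \<alpha> * 2" using C e by (intro mult_left_mono) auto
    finally have "r powr \<alpha> \<le> 4 * C / l"
      using False l(1) by (simp add: powr_divide field_simps)
    then have "(r powr \<alpha>) powr (1 / \<alpha>) \<le> (4 * C / l) powr (1 / \<alpha>)"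
      using \<alpha> by (intro powr_mono2) auto
    then show ?thesis using False \<alpha> by (simp add: powr_powr M_def)
  qed (simp add: M_def)
  then show ?thesis by (rule bdd_aboveI)
qed

lemma admissible_le_\<rho>: "r \<in> admissible_radii x \<Longrightarrow> r \<le> \<rho> x"
  unfolding \<rho>_def by (intro cSup_upper admissible_bdd_above)

lemma \<rho>_pos: "0 < \<rho> x"
proof -
  obtain r where "r \<in> admissible_radii x" using admissible_nonempty by blast
  then show ?thesis using admissible_le_\<rho>[of r x] by (auto simp: admissible_radii_def)
qed

text \<open>The radius \<open>2 \<rho>(x)\<close> is no longer admissible, so \<open>\<Psi>(x, 2 \<rho>(x)) > 1\<close> in every direction; doubling
  transfers this to \<open>\<rho>(x)\<close> and so replaces a continuity argument in the radius.\<close>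

lemma critical_cube_lower_bound:
  "\<rho> x powr (real CARD('n) - 2) * (norm e)\<^sup>2 \<le> D * mass V e (cube x (\<rho> x))"
proof (cases "e = 0")
  case False
  define e' where "e' = e /\<^sub>R norm e"
  let ?n = "real CARD('n)"
  have e': "norm e' = 1" using False by (simp add: e'_def)
  have "2 * \<rho> x \<notin> admissible_radii x"
    using admissible_le_\<rho>[of "2 * \<rho> x" x] \<rho>_pos[of x] by auto
  then have "1 < \<psi> x (2 * \<rho> x) e'"
    using admissibleI[OF _ e', of "2 * \<rho> x" x] \<rho>_pos[of x] by force
  also have "\<psi> x (2 * \<rho> x) e' = 2 powr (2 - ?n) * (\<rho> x powr (2 - ?n) * mass V e' (cube x (2 * \<rho> x)))"
    using \<rho>_pos[of x] by (simp add: \<psi>_eq powr_mult)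
  also have "\<dots> \<le> 1 * (\<rho> x powr (2 - ?n) * mass V e' (cube x (2 * \<rho> x)))"
    using n powr_mono[of "2 - ?n" 0 2] by (intro mult_right_mono mult_nonneg_nonneg mass_cube_nonneg) auto
  also have "\<dots> \<le> 1 * (\<rho> x powr (2 - ?n) * (D * mass V e' (cube x (\<rho> x))))"
    using \<rho>_pos[of x] by (intro mult_left_mono doubling) auto
  finally have "\<rho> x powr (?n - 2) * 1 \<le> \<rho> x powr (?n - 2) * (\<rho> x powr (2 - ?n) * (D * mass V e' (cube x (\<rho> x))))"
    by (intro mult_left_mono) auto
  then have "\<rho> x powr (?n - 2) \<le> D * mass V e' (cube x (\<rho> x))"
    using \<rho>_pos[of x] by (simp add: mult.assoc[symmetric] powr_add[symmetric])
  also have "mass V e' (cube x (\<rho> x)) = mass V e (cube x (\<rho> x)) / (norm e)\<^sup>2"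
    by (simp add: e'_def matrix_vector_mult_scaleR power2_eq_square divide_inverse mult_ac)
  finally show ?thesis using False by (simp add: field_simps)
qed simp

text \<open>Some admissible radius exceeds \<open>\<rho>(x) / 2\<close>; its good direction remains good at \<open>\<rho>(x)\<close> by doubling.\<close>

lemma critical_cube_upper_bound:
  obtains e where "norm e = 1" "mass V e (cube x (\<rho> x)) \<le> 2 * D * \<rho> x powr (real CARD('n) - 2)"
proof -
  let ?n = "real CARD('n)"
  have "\<rho> x / 2 < Sup (admissible_radii x)" using \<rho>_pos[of x] by (simp add: \<rho>_def[symmetric])
  then obtain s where s: "s \<in> admissible_radii x" "\<rho> x / 2 < s"
    using less_cSup_iff[OF admissible_nonempty admissible_bdd_above] by blast
  have s': "0 < s" "s \<le> \<rho> x" using s admissible_le_\<rho> by (auto simp: admissible_radii_def)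
  obtain e where e: "norm e = 1" "\<psi> x s e \<le> 2" using s(1) by (rule admissibleE)
  have "mass V e (cube x (\<rho> x)) \<le> mass V e (cube x (2 * s))"
    using s by (intro mass_mono[of _ _ x "2 * s"] cube_mono) auto
  also have "\<dots> \<le> D * mass V e (cube x s)" using s' by (intro doubling)
  also have "mass V e (cube x s) = s powr (?n - 2) * \<psi> x s e" using s'(1) by (rule mass_eq_\<psi>)
  also have "\<dots> \<le> \<rho> x powr (?n - 2) * 2"
    using s' e n by (intro mult_mono powr_mono2 \<psi>_nonneg) auto
  finally have "mass V e (cube x (\<rho> x)) \<le> 2 * D * \<rho> x powr (?n - 2)" using D by (simp add: mult_ac)
  then show ?thesis using e that by blast
qed

text \<open>The factor by which the critical radius may vary within a critical cube, chosen to make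
  \<open>4 C D\<^sup>2 \<eta>\<^sup>\<alpha> = 1\<close> in the next estimate.\<close>

definition \<eta> :: real where "\<eta> = (1 / (4 * C * D\<^sup>2)) powr (1 / \<alpha>)"

lemma \<eta>: "0 < \<eta>" "\<eta> \<le> 1" "4 * C * D\<^sup>2 * \<eta> powr \<alpha> = 1"
proof -
  have "1 \<le> C * D\<^sup>2" using C D mult_mono[of 1 C 1 "D\<^sup>2"] by simp
  then show "0 < \<eta>" "\<eta> \<le> 1" "4 * C * D\<^sup>2 * \<eta> powr \<alpha> = 1"
    using C D \<alpha> by (auto simp: \<eta>_def powr_powr intro!: powr_le1)
qed

text \<open>The direction \<open>e\<close> in which \<open>\<Psi>(x, \<rho>(x))\<close> is bounded is used at \<open>y\<close> as well: by doubling \<open>\<Psi>(y, \<rho>(x))\<close> is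
  bounded at \<open>e\<close>, and by decay shrinking the radius by \<open>\<eta>\<close> brings it below 1. So \<open>\<eta> \<rho>(x)\<close> is admissible at \<open>y\<close>.\<close>

lemma \<rho>_lower_on_cube:
  assumes y: "y \<in> cube x (\<rho> x)"
  shows "\<eta> * \<rho> x \<le> \<rho> y"
proof -
  let ?n = "real CARD('n)"
  obtain e where e: "norm e = 1" "mass V e (cube x (\<rho> x)) \<le> 2 * D * \<rho> x powr (?n - 2)"
    by (rule critical_cube_upper_bound)
  have r: "0 < \<rho> x" by (rule \<rho>_pos)
  have "mass V e (cube y (\<rho> x)) \<le> mass V e (cube x (2 * \<rho> x))"
  proof (rule mass_mono[of _ _ x "2 * \<rho> x"])
    show "cube y (\<rho> x) \<subseteq> cube x (2 * \<rho> x)"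
    proof
      fix z assume z: "z \<in> cube y (\<rho> x)"
      have "\<bar>z $ i - x $ i\<bar> \<le> 2 * \<rho> x" for i
      proof -
        have "\<bar>z $ i - y $ i\<bar> \<le> \<rho> x" "\<bar>y $ i - x $ i\<bar> \<le> \<rho> x" using z y by (auto simp: mem_cube)
        then show ?thesis by linarith
      qed
      then show "z \<in> cube x (2 * \<rho> x)" by (simp add: mem_cube)
    qed
  qed auto
  also have "\<dots> \<le> D * mass V e (cube x (\<rho> x))" by (intro doubling r)
  also have "\<dots> \<le> D * (2 * D * \<rho> x powr (?n - 2))" using D e by (intro mult_left_mono) auto
  finally have "\<rho> x powr (2 - ?n) * mass V e (cube y (\<rho> x)) \<le> \<rho> x powr (2 - ?n) * (D * (2 * D * \<rho> x powr (?n - 2)))"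
    by (intro mult_left_mono) auto
  also have "\<dots> = 2 * D\<^sup>2 * (\<rho> x powr (2 - ?n) * \<rho> x powr (?n - 2))" by (simp add: power2_eq_square)
  also have "\<rho> x powr (2 - ?n) * \<rho> x powr (?n - 2) = 1" using r by (simp add: powr_add[symmetric])
  finally have *: "\<psi> y (\<rho> x) e \<le> 2 * D\<^sup>2" by (simp add: \<psi>_eq)
  have "\<eta> * \<rho> x \<le> \<rho> x" using \<eta> r by (simp add: mult_le_cancel_right1)
  then have "\<psi> y (\<eta> * \<rho> x) e \<le> 2 * C * (\<eta> * \<rho> x / \<rho> x) powr \<alpha> * \<psi> y (\<rho> x) e"
    using \<eta> r by (intro \<psi>_decay) auto
  also have "\<dots> \<le> 2 * C * \<eta> powr \<alpha> * (2 * D\<^sup>2)"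
    using r C * by (intro mult_mono) (auto intro!: \<psi>_nonneg)
  also have "\<dots> = 1" using \<eta>(3) by (simp add: mult_ac)
  finally have "\<eta> * \<rho> x \<in> admissible_radii y" using \<eta> r e by (intro admissibleI) auto
  then show ?thesis by (rule admissible_le_\<rho>)
qed

text \<open>If \<open>\<rho>(y) > \<rho>(x)\<close>, then \<open>x\<close> lies in the critical cube at \<open>y\<close> and the roles can be exchanged.\<close>

lemma \<rho>_upper_on_cube:
  assumes y: "y \<in> cube x (\<rho> x)"
  shows "\<eta> * \<rho> y \<le> \<rho> x"
proof (cases "\<rho> y \<le> \<rho> x")
  case True
  then show ?thesis using \<eta> \<rho>_pos[of y] mult_mono[of \<eta> 1 "\<rho> y" "\<rho> x"] by simp
next
  case False
  have "x \<in> cube x (\<rho> x)" by (simp add: mem_cube less_imp_le \<rho>_pos)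
  then have "x \<in> cube y (\<rho> y)" using y False
    by (auto simp: mem_cube abs_minus_commute intro: order_trans)
  then show ?thesis by (rule \<rho>_lower_on_cube)
qed

end

section \<open>A weighted Poincare inequality\<close>

lemma norm_matrix_vector_le:
  fixes A :: "real^'n^'m"
  shows "norm (A *v x) \<le> norm A * norm x"
proof -
  have "norm (A *v x) = L2_set (\<lambda>i. norm ((A *v x) $ i)) UNIV" by (simp add: norm_vec_def)
  also have "\<dots> \<le> L2_set (\<lambda>i. norm (A $ i) * norm x) UNIV"
    by (intro L2_set_mono) (auto simp: matrix_vector_mul_component Cauchy_Schwarz_ineq2)
  also have "\<dots> = norm A * norm x"
    by (subst (2) norm_vec_def) (simp add: L2_set_left_distrib)
  finally show ?thesis .
qed

lemma norm_diff_in_cube: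
  fixes y z :: "real^'n"
  assumes "y \<in> cube x r" "z \<in> cube x r"
  shows "norm (y - z) \<le> 2 * real CARD('n) * r"
proof -
  have "norm (y - z) \<le> (\<Sum>i\<in>UNIV. \<bar>(y - z) $ i\<bar>)" by (rule norm_le_l1_cart)
  also have "\<dots> \<le> (\<Sum>i\<in>(UNIV :: 'n set). 2 * r)"
  proof (rule sum_mono)
    fix i
    have "\<bar>y $ i - x $ i\<bar> \<le> r" "\<bar>z $ i - x $ i\<bar> \<le> r" using assms by (auto simp: mem_cube)
    then show "\<bar>(y - z) $ i\<bar> \<le> 2 * r" by simp
  qed
  finally show ?thesis by simp
qed

lemma nn_integral_powr_unit_interval:
  assumes "0 < (d :: real)"
  shows "(\<integral>\<^sup>+t. indicator {0..1} t * ennreal (t powr (d - 1)) \<partial>lborel) = ennreal (1 / d)"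
  using nn_integral_has_integral_lebesgue[OF _ has_integral_powr_from_0[of "d - 1" 1]] assms
  by (simp add: ennreal_mult' ennreal_indicator)

text \<open>The fundamental theorem of calculus along the segment, with the Cauchy-Schwarz inequality for the
  splitting \<open>1 = t\<^sup>(\<^sup>d\<^sup>-\<^sup>1\<^sup>)\<^sup>/\<^sup>2 t\<^sup>(\<^sup>1\<^sup>-\<^sup>d\<^sup>)\<^sup>/\<^sup>2\<close>. For small \<open>d\<close> the weight \<open>t\<^sup>1\<^sup>-\<^sup>d\<close> gains almost a full power of \<open>t\<close>
  near \<open>z\<close>, which lets the Poincare inequality below tolerate the singularity of its weight.\<close>

lemma segment_bound:
  fixes u :: "real^'n \<Rightarrow> real^'d"
  assumes diff: "\<And>x. u differentiable (at x)"
    and cont: "continuous_on UNIV (\<lambda>x. jacobian u (at x))"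
    and d: "0 < d"
  shows "ennreal ((norm (u y - u z))\<^sup>2) \<le> ennreal ((norm (y - z))\<^sup>2 / d) *
    (\<integral>\<^sup>+t. indicator {0..1} t * ennreal (t powr (1 - d)) *
        ennreal ((norm (jacobian u (at (z + t *\<^sub>R (y - z)))))\<^sup>2) \<partial>lborel)"
proof -
  define g where "g t = norm (jacobian u (at (z + t *\<^sub>R (y - z))))" for t
  have contg: "continuous_on S g" for S
    unfolding g_def
    by (intro continuous_on_norm continuous_on_compose2[OF cont] continuous_intros) auto
  have [measurable]: "g \<in> borel_measurable borel"
    using contg by (rule borel_measurable_continuous_onI)
  have deriv: "((\<lambda>t. u (z + t *\<^sub>R (y - z))) has_vector_derivative
      jacobian u (at (z + t *\<^sub>R (y - z))) *v (y - z)) (at t within {0..1})" for t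
  proof -
    have "((\<lambda>t. z + t *\<^sub>R (y - z)) has_derivative (\<lambda>h. h *\<^sub>R (y - z))) (at t within {0..1})"
      by (auto intro!: derivative_eq_intros)
    moreover have "(u has_derivative (\<lambda>h. jacobian u (at (z + t *\<^sub>R (y - z))) *v h)) (at (z + t *\<^sub>R (y - z)))"
      using diff jacobian_works by blast
    ultimately have "(u \<circ> (\<lambda>t. z + t *\<^sub>R (y - z)) has_derivative
        (\<lambda>h. jacobian u (at (z + t *\<^sub>R (y - z))) *v h) \<circ> (\<lambda>h. h *\<^sub>R (y - z))) (at t within {0..1})"
      by (rule diff_chain_within[OF _ has_derivative_at_withinI])
    then show ?thesis
      by (simp add: has_vector_derivative_def o_def matrix_vector_mult_scaleR)
  qed
  have int: "((\<lambda>t. jacobian u (at (z + t *\<^sub>R (y - z))) *v (y - z)) has_integral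
      (u y - u z)) {0..1}"
    using fundamental_theorem_of_calculus[OF _ deriv] by simp
  have gint: "(\<lambda>t. g t * norm (y - z)) integrable_on {0..1}"
    by (intro integrable_continuous_interval continuous_intros contg)
  have "norm (u y - u z) \<le> integral {0..1} (\<lambda>t. g t * norm (y - z))"
    using int integral_norm_bound_integral[OF has_integral_integrable[OF int] gint]
    by (simp add: g_def norm_matrix_vector_le integral_unique)
  then have "ennreal (norm (u y - u z)) \<le> ennreal (integral {0..1} (\<lambda>t. g t * norm (y - z)))"
    by (rule ennreal_leI)
  also have "\<dots> = (\<integral>\<^sup>+t. indicator {0..1} t * ennreal (g t * norm (y - z)) \<partial>lborel)"
    using nn_integral_has_integral_lebesgue[OF _ integrable_integral[OF gint]]
    by (simp add: g_def ennreal_mult' ennreal_indicator)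
  also have "\<dots> = (\<integral>\<^sup>+t. (indicator {0..1} t * ennreal (t powr ((d - 1) / 2))) *
     (indicator {0..1} t * ennreal (norm (y - z) * t powr ((1 - d) / 2) * g t)) \<partial>lborel)"
  proof (rule nn_integral_cong_AE)
    have "AE t in lborel. t \<noteq> (0::real)" by (rule AE_lborel_singleton)
    then show "AE t in lborel. indicator {0..1} t * ennreal (g t * norm (y - z)) =
       (indicator {0..1} t * ennreal (t powr ((d - 1) / 2))) *
     (indicator {0..1} t * ennreal (norm (y - z) * t powr ((1 - d) / 2) * g t))"
    proof eventually_elim
      fix t :: real assume "t \<noteq> 0"
      show "indicator {0..1} t * ennreal (g t * norm (y - z)) =
       (indicator {0..1} t * ennreal (t powr ((d - 1) / 2))) *
     (indicator {0..1} t * ennreal (norm (y - z) * t powr ((1 - d) / 2) * g t))"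
      proof (cases "t \<in> {0..1}")
        case True
        have "t powr ((d - 1) / 2) * t powr ((1 - d) / 2) = 1"
          using True \<open>t \<noteq> 0\<close> by (simp add: powr_add[symmetric] add_divide_distrib[symmetric])
        then have "g t * norm (y - z) = t powr ((d - 1) / 2) * (norm (y - z) * t powr ((1 - d) / 2) * g t)"
          by (metis (no_types, lifting) mult.assoc mult.commute mult.right_neutral)
        then have "ennreal (g t * norm (y - z))
            = ennreal (t powr ((d - 1) / 2) * (norm (y - z) * t powr ((1 - d) / 2) * g t))"
          by (rule arg_cong)
        also have "\<dots> = ennreal (t powr ((d - 1) / 2)) * ennreal (norm (y - z) * t powr ((1 - d) / 2) * g t)"
          by (intro ennreal_mult) (auto simp: g_def)
        finally show ?thesis using True by (simp only: indicator_simps mult_1_left)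
      qed simp
    qed
  qed
  finally have "ennreal (norm (u y - u z)) ^ 2 \<le> \<dots> ^ 2"
    by (intro power_mono) auto
  also have "\<dots> \<le> (\<integral>\<^sup>+t. (indicator {0..1} t * ennreal (t powr ((d - 1) / 2)))\<^sup>2 \<partial>lborel) *
     (\<integral>\<^sup>+t. (indicator {0..1} t * ennreal (norm (y - z) * t powr ((1 - d) / 2) * g t))\<^sup>2 \<partial>lborel)"
    by (rule Cauchy_Schwarz_nn_integral) measurable
  also have "(\<integral>\<^sup>+t. (indicator {0..1} t * ennreal (t powr ((d - 1) / 2)))\<^sup>2 \<partial>lborel) = ennreal (1 / d)"
  proof -
    have "(indicator {0..1} t * ennreal (t powr ((d - 1) / 2)))\<^sup>2 = indicator {0..1} t * ennreal (t powr (d - 1))" for t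
      by (auto simp: indicator_def ennreal_power power2_eq_square powr_add[symmetric] ennreal_mult'[symmetric])
    then show ?thesis by (simp add: nn_integral_powr_unit_interval d)
  qed
  also have "(\<integral>\<^sup>+t. (indicator {0..1} t * ennreal (norm (y - z) * t powr ((1 - d) / 2) * g t))\<^sup>2 \<partial>lborel)
     = (\<integral>\<^sup>+t. ennreal ((norm (y - z))\<^sup>2) * (indicator {0..1} t * ennreal (t powr (1 - d)) * ennreal ((g t)\<^sup>2)) \<partial>lborel)"
  proof (rule nn_integral_cong)
    fix t
    have "(norm (y - z) * t powr ((1 - d) / 2) * g t)\<^sup>2 = (norm (y - z))\<^sup>2 * (t powr (1 - d) * (g t)\<^sup>2)"
      by (simp add: power_mult_distrib power2_eq_square[of "t powr _"] powr_add[symmetric])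
    then show "(indicator {0..1} t * ennreal (norm (y - z) * t powr ((1 - d) / 2) * g t))\<^sup>2
      = ennreal ((norm (y - z))\<^sup>2) * (indicator {0..1} t * ennreal (t powr (1 - d)) * ennreal ((g t)\<^sup>2))"
      by (auto simp: indicator_def ennreal_power g_def ennreal_mult'[symmetric])
  qed
  also have "\<dots> = ennreal ((norm (y - z))\<^sup>2) * (\<integral>\<^sup>+t. indicator {0..1} t * ennreal (t powr (1 - d)) * ennreal ((g t)\<^sup>2) \<partial>lborel)"
    by (rule nn_integral_cmult) measurable
  finally show ?thesis
    using d unfolding g_def
    by (simp add: ennreal_power mult.assoc[symmetric] ennreal_mult'[symmetric] mult.commute)
qed

lemma nn_integral_lborel_affine:
  fixes c :: "real^'n"
  assumes t: "0 < t" and [measurable]: "F \<in> borel_measurable borel"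
  shows "(\<integral>\<^sup>+y. F (c + t *\<^sub>R y) \<partial>lborel) = ennreal (t powr - real CARD('n)) * (\<integral>\<^sup>+s. F s \<partial>lborel)"
proof -
  have "(\<integral>\<^sup>+s. F s \<partial>lborel) = (\<integral>\<^sup>+y. ennreal (t ^ CARD('n)) * F (c + t *\<^sub>R y) \<partial>lborel)"
    by (subst lborel_affine[of t c]) (use t in \<open>auto simp: nn_integral_density nn_integral_distr\<close>)
  also have "\<dots> = ennreal (t ^ CARD('n)) * (\<integral>\<^sup>+y. F (c + t *\<^sub>R y) \<partial>lborel)"
    by (rule nn_integral_cmult) measurable
  finally show ?thesis
    using t by (simp add: powr_minus powr_realpow mult.assoc[symmetric] ennreal_mult'[symmetric])
qed

text \<open>After \<open>segment_bound\<close> and Tonelli, substitute \<open>s = z + t (y - z)\<close> for \<open>y\<close> at fixed \<open>t\<close> and \<open>z\<close>. The point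
  \<open>s\<close> stays in the cube, and \<open>z\<close> lies in the cube of half side \<open>2 r t\<close> about \<open>s\<close>, where the weight has mass
  at most \<open>K t\<^sup>n\<^sup>-\<^sup>2\<^sup>+\<^sup>a\<close>. With the Jacobian \<open>t\<^sup>-\<^sup>n\<close> and the factor \<open>t\<^sup>1\<^sup>-\<^sup>d\<close> this leaves the integral of
  \<open>t\<^sup>a\<^sup>-\<^sup>d\<^sup>-\<^sup>1\<close> over the unit interval, which is finite for \<open>d = a/2\<close>.\<close>

lemma weighted_poincare:
  fixes u :: "real^'n \<Rightarrow> real^'d" and w :: "real^'n \<Rightarrow> ennreal"
  assumes diff: "\<And>x. u differentiable (at x)"
    and cont: "continuous_on UNIV (\<lambda>x. jacobian u (at x))"
    and [measurable]: "w \<in> borel_measurable borel"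
    and r: "0 < r" and a: "0 < a" and K: "0 \<le> K"
    and growth: "\<And>s t. s \<in> cube x r \<Longrightarrow> 0 < t \<Longrightarrow> t \<le> 1 \<Longrightarrow>
      (\<integral>\<^sup>+z. indicator (cube x r) z * indicator (cube s (2 * r * t)) z * w z \<partial>lborel)
        \<le> ennreal (K * t powr (real CARD('n) - 2 + a))"
  shows "(\<integral>\<^sup>+y. \<integral>\<^sup>+z. indicator (cube x r) y * (indicator (cube x r) z * w z) *
            ennreal ((norm (u y - u z))\<^sup>2) \<partial>lborel \<partial>lborel)
    \<le> ennreal (16 * (real CARD('n))\<^sup>2 * K / a\<^sup>2 * r\<^sup>2) *
       (\<integral>\<^sup>+y. indicator (cube x r) y * ennreal ((norm (jacobian u (at y)))\<^sup>2) \<partial>lborel)"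
proof -
  let ?n = "real CARD('n)"
  define Q where "Q = cube x r"
  define d where "d = a / 2"
  define G where "G y = ennreal ((norm (jacobian u (at y)))\<^sup>2)" for y
  define k where "k t = indicator {0..1} t * ennreal (t powr (1 - d))" for t :: real
  define L where "L = (2 * ?n * r)\<^sup>2 / d"
  have d: "0 < d" using a by (simp add: d_def)
  have Qm[measurable]: "Q \<in> sets borel" by (simp add: Q_def)
  have Gm[measurable]: "G \<in> borel_measurable borel"
    unfolding G_def using cont
    by (intro measurable_compose[OF _ measurable_ennreal] borel_measurable_continuous_onI continuous_intros)
  have km[measurable]: "k \<in> borel_measurable borel" unfolding k_def by measurable
  define H where "H y z t = indicator Q y * (indicator Q z * w z) * (k t * G (z + t *\<^sub>R (y - z)))" for y z t
  have Hm[measurable (raw)]: "(\<lambda>\<omega>. H (f \<omega>) (g \<omega>) (h \<omega>)) \<in> borel_measurable M"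
    if [measurable]: "f \<in> borel_measurable M" "g \<in> borel_measurable M" "h \<in> borel_measurable M"
    for f g h and M :: "'m measure"
    unfolding H_def by measurable
  have "(\<integral>\<^sup>+y. \<integral>\<^sup>+z. indicator Q y * (indicator Q z * w z) * ennreal ((norm (u y - u z))\<^sup>2) \<partial>lborel \<partial>lborel)
    \<le> (\<integral>\<^sup>+y. \<integral>\<^sup>+z. ennreal L * (\<integral>\<^sup>+t. H y z t \<partial>lborel) \<partial>lborel \<partial>lborel)"
  proof (intro nn_integral_mono)
    fix y z
    show "indicator Q y * (indicator Q z * w z) * ennreal ((norm (u y - u z))\<^sup>2) \<le> ennreal L * (\<integral>\<^sup>+t. H y z t \<partial>lborel)"
    proof (cases "y \<in> Q \<and> z \<in> Q")
      case True
      then have "norm (y - z) \<le> 2 * ?n * r" unfolding Q_def by (intro norm_diff_in_cube) auto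
      then have "(norm (y - z))\<^sup>2 / d \<le> L" unfolding L_def using d by (intro divide_right_mono power_mono) auto
      have "ennreal ((norm (u y - u z))\<^sup>2) \<le> ennreal ((norm (y - z))\<^sup>2 / d) * (\<integral>\<^sup>+t. k t * G (z + t *\<^sub>R (y - z)) \<partial>lborel)"
        unfolding k_def G_def by (rule segment_bound[OF diff cont d])
      also have "\<dots> \<le> ennreal L * (\<integral>\<^sup>+t. k t * G (z + t *\<^sub>R (y - z)) \<partial>lborel)"
        by (intro mult_right_mono ennreal_leI) (fact, simp)
      finally have "w z * ennreal ((norm (u y - u z))\<^sup>2) \<le> w z * (ennreal L * (\<integral>\<^sup>+t. k t * G (z + t *\<^sub>R (y - z)) \<partial>lborel))"
        by (rule mult_left_mono) simp
      also have "\<dots> = ennreal L * (\<integral>\<^sup>+t. H y z t \<partial>lborel)"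
      proof -
        have "(\<integral>\<^sup>+t. H y z t \<partial>lborel) = (\<integral>\<^sup>+t. w z * (k t * G (z + t *\<^sub>R (y - z))) \<partial>lborel)"
          using True by (simp add: H_def)
        also have "\<dots> = w z * (\<integral>\<^sup>+t. k t * G (z + t *\<^sub>R (y - z)) \<partial>lborel)"
          by (rule nn_integral_cmult) measurable
        finally show ?thesis by (simp add: mult.left_commute)
      qed
      finally show ?thesis using True by simp
    qed auto
  qed
  also have "\<dots> = ennreal L * (\<integral>\<^sup>+y. \<integral>\<^sup>+z. \<integral>\<^sup>+t. H y z t \<partial>lborel \<partial>lborel \<partial>lborel)"
    by (subst nn_integral_cmult, measurable, rule nn_integral_cmult, measurable)
  also have "(\<integral>\<^sup>+y. \<integral>\<^sup>+z. \<integral>\<^sup>+t. H y z t \<partial>lborel \<partial>lborel \<partial>lborel)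
     = (\<integral>\<^sup>+y. \<integral>\<^sup>+t. \<integral>\<^sup>+z. H y z t \<partial>lborel \<partial>lborel \<partial>lborel)"
    by (intro nn_integral_cong lborel_pair.Fubini') measurable
  also have "\<dots> = (\<integral>\<^sup>+t. \<integral>\<^sup>+y. \<integral>\<^sup>+z. H y z t \<partial>lborel \<partial>lborel \<partial>lborel)"
    by (intro lborel_pair.Fubini') measurable
  also have "\<dots> = (\<integral>\<^sup>+t. \<integral>\<^sup>+z. \<integral>\<^sup>+y. H y z t \<partial>lborel \<partial>lborel \<partial>lborel)"
    by (intro nn_integral_cong lborel_pair.Fubini') measurable
  also have "\<dots> \<le> (\<integral>\<^sup>+t. ennreal K * (\<integral>\<^sup>+s. indicator Q s * G s \<partial>lborel) * (indicator {0..1} t * ennreal (t powr (d - 1))) \<partial>lborel)"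
  proof (rule nn_integral_mono_AE)
    have "AE t in lborel. t \<noteq> (0::real)" by (rule AE_lborel_singleton)
    then show "AE t in lborel. (\<integral>\<^sup>+z. \<integral>\<^sup>+y. H y z t \<partial>lborel \<partial>lborel)
      \<le> ennreal K * (\<integral>\<^sup>+s. indicator Q s * G s \<partial>lborel) * (indicator {0..1} t * ennreal (t powr (d - 1)))"
    proof eventually_elim
      fix t :: real assume "t \<noteq> 0"
      show "(\<integral>\<^sup>+z. \<integral>\<^sup>+y. H y z t \<partial>lborel \<partial>lborel)
      \<le> ennreal K * (\<integral>\<^sup>+s. indicator Q s * G s \<partial>lborel) * (indicator {0..1} t * ennreal (t powr (d - 1)))"
      proof (cases "t \<in> {0..1}")
        case False
        then show ?thesis by (simp add: H_def k_def)
      next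
        case True
        then have t: "0 < t" "t \<le> 1" using \<open>t \<noteq> 0\<close> by auto
        define F where "F z s = indicator Q s * (indicator (cube 0 (2 * r * t)) (z - s) * G s)" for z s
        have Fm[measurable (raw)]: "(\<lambda>\<omega>. F (f \<omega>) (g \<omega>)) \<in> borel_measurable M"
          if [measurable]: "f \<in> borel_measurable M" "g \<in> borel_measurable M"
          for f g and M :: "'m measure"
          unfolding F_def by measurable
        have mem_shift: "indicator (cube 0 (2 * r * t)) (z - s) = (indicator (cube s (2 * r * t)) z :: ennreal)" for z s :: "real^'n"
          by (simp add: indicator_def mem_cube)
        have inner: "(\<integral>\<^sup>+y. indicator Q y * G (z + t *\<^sub>R (y - z)) \<partial>lborel)
          \<le> ennreal (t powr - ?n) * (\<integral>\<^sup>+s. F z s \<partial>lborel)" if z: "z \<in> Q" for z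
        proof -
          have "(\<integral>\<^sup>+y. indicator Q y * G (z + t *\<^sub>R (y - z)) \<partial>lborel)
            \<le> (\<integral>\<^sup>+y. F z ((1 - t) *\<^sub>R z + t *\<^sub>R y) \<partial>lborel)"
          proof (rule nn_integral_mono)
            fix y
            show "indicator Q y * G (z + t *\<^sub>R (y - z)) \<le> F z ((1 - t) *\<^sub>R z + t *\<^sub>R y)"
            proof (cases "y \<in> Q")
              case True
              have e: "z + t *\<^sub>R (y - z) = (1 - t) *\<^sub>R z + t *\<^sub>R y" by (simp add: algebra_simps)
              have "(1 - t) *\<^sub>R z + t *\<^sub>R y \<in> Q"
                using z True t unfolding Q_def cube_def by (intro convexD[OF convex_box(1)]) auto
              moreover have "\<bar>z $ i - ((1 - t) *\<^sub>R z + t *\<^sub>R y) $ i\<bar> \<le> 2 * r * t" for i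
              proof -
                have "z $ i - ((1 - t) *\<^sub>R z + t *\<^sub>R y) $ i = t * (z $ i - y $ i)" by (simp add: algebra_simps)
                moreover have "\<bar>y $ i - x $ i\<bar> \<le> r" "\<bar>z $ i - x $ i\<bar> \<le> r"
                  using z True by (auto simp: Q_def mem_cube)
                then have "\<bar>z $ i - y $ i\<bar> \<le> 2 * r" by linarith
                then have "t * \<bar>z $ i - y $ i\<bar> \<le> t * (2 * r)" using t by (intro mult_left_mono) auto
                ultimately show ?thesis using t by (simp add: abs_mult mult_ac)
              qed
              ultimately show ?thesis by (simp add: F_def mem_shift e mem_cube True)
            qed simp
          qed
          also have "\<dots> = ennreal (t powr - ?n) * (\<integral>\<^sup>+s. F z s \<partial>lborel)"
            by (rule nn_integral_lborel_affine[OF t(1)]) measurable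
          finally show ?thesis .
        qed
        have "(\<integral>\<^sup>+z. \<integral>\<^sup>+y. H y z t \<partial>lborel \<partial>lborel)
          = (\<integral>\<^sup>+z. (indicator Q z * w z * k t) * (\<integral>\<^sup>+y. indicator Q y * G (z + t *\<^sub>R (y - z)) \<partial>lborel) \<partial>lborel)"
        proof (rule nn_integral_cong)
          fix z
          have "(\<integral>\<^sup>+y. H y z t \<partial>lborel)
            = (\<integral>\<^sup>+y. (indicator Q z * w z * k t) * (indicator Q y * G (z + t *\<^sub>R (y - z))) \<partial>lborel)"
            unfolding H_def by (intro nn_integral_cong) (simp only: mult_ac)
          also have "\<dots> = (indicator Q z * w z * k t) * (\<integral>\<^sup>+y. indicator Q y * G (z + t *\<^sub>R (y - z)) \<partial>lborel)"
            by (rule nn_integral_cmult) measurable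
          finally show "(\<integral>\<^sup>+y. H y z t \<partial>lborel) = \<dots>" .
        qed
        also have "\<dots> \<le> (\<integral>\<^sup>+z. (indicator Q z * w z * k t) * (ennreal (t powr - ?n) * (\<integral>\<^sup>+s. F z s \<partial>lborel)) \<partial>lborel)"
        proof (rule nn_integral_mono)
          fix z
          show "(indicator Q z * w z * k t) * (\<integral>\<^sup>+y. indicator Q y * G (z + t *\<^sub>R (y - z)) \<partial>lborel)
            \<le> (indicator Q z * w z * k t) * (ennreal (t powr - ?n) * (\<integral>\<^sup>+s. F z s \<partial>lborel))"
          proof (cases "z \<in> Q")
            case True
            then show ?thesis by (intro mult_left_mono inner) auto
          qed simp
        qed
        also have "\<dots> = (\<integral>\<^sup>+z. \<integral>\<^sup>+s. (k t * ennreal (t powr - ?n)) * ((indicator Q z * w z) * F z s) \<partial>lborel \<partial>lborel)"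
        proof (rule nn_integral_cong)
          fix z
          have "(\<integral>\<^sup>+s. (k t * ennreal (t powr - ?n)) * ((indicator Q z * w z) * F z s) \<partial>lborel)
            = (\<integral>\<^sup>+s. (k t * ennreal (t powr - ?n) * (indicator Q z * w z)) * F z s \<partial>lborel)"
            by (simp only: mult.assoc)
          also have "\<dots> = (k t * ennreal (t powr - ?n) * (indicator Q z * w z)) * (\<integral>\<^sup>+s. F z s \<partial>lborel)"
            by (rule nn_integral_cmult) measurable
          finally show "(indicator Q z * w z * k t) * (ennreal (t powr - ?n) * (\<integral>\<^sup>+s. F z s \<partial>lborel))
            = (\<integral>\<^sup>+s. (k t * ennreal (t powr - ?n)) * ((indicator Q z * w z) * F z s) \<partial>lborel)"
            by (simp only: mult_ac)
        qed
        also have "\<dots> = (\<integral>\<^sup>+s. \<integral>\<^sup>+z. (k t * ennreal (t powr - ?n)) * ((indicator Q z * w z) * F z s) \<partial>lborel \<partial>lborel)"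
          by (intro lborel_pair.Fubini') measurable
        also have "\<dots> = (\<integral>\<^sup>+s. (k t * ennreal (t powr - ?n)) * ((indicator Q s * G s) *
            (\<integral>\<^sup>+z. indicator Q z * indicator (cube s (2 * r * t)) z * w z \<partial>lborel)) \<partial>lborel)"
        proof (rule nn_integral_cong)
          fix s :: "real^'n"
          have [measurable]: "cube s (2 * r * t) \<in> sets borel" by simp
          show "(\<integral>\<^sup>+z. (k t * ennreal (t powr - ?n)) * ((indicator Q z * w z) * F z s) \<partial>lborel)
            = (k t * ennreal (t powr - ?n)) * ((indicator Q s * G s) *
            (\<integral>\<^sup>+z. indicator Q z * indicator (cube s (2 * r * t)) z * w z \<partial>lborel))"
          proof -
            have "(\<integral>\<^sup>+z. (k t * ennreal (t powr - ?n)) * ((indicator Q z * w z) * F z s) \<partial>lborel)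
              = (\<integral>\<^sup>+z. (k t * ennreal (t powr - ?n) * (indicator Q s * G s)) *
                  (indicator Q z * indicator (cube s (2 * r * t)) z * w z) \<partial>lborel)"
              unfolding F_def mem_shift by (intro nn_integral_cong) (simp only: mult_ac)
            also have "\<dots> = (k t * ennreal (t powr - ?n) * (indicator Q s * G s)) *
                  (\<integral>\<^sup>+z. indicator Q z * indicator (cube s (2 * r * t)) z * w z \<partial>lborel)"
              by (rule nn_integral_cmult) measurable
            finally show ?thesis by (simp only: mult.assoc)
          qed
        qed
        also have "\<dots> \<le> (\<integral>\<^sup>+s. (k t * ennreal (t powr - ?n)) * ((indicator Q s * G s) *
            ennreal (K * t powr (?n - 2 + a))) \<partial>lborel)"
        proof (rule nn_integral_mono)
          fix s
          show "(k t * ennreal (t powr - ?n)) * ((indicator Q s * G s) *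
            (\<integral>\<^sup>+z. indicator Q z * indicator (cube s (2 * r * t)) z * w z \<partial>lborel))
           \<le> (k t * ennreal (t powr - ?n)) * ((indicator Q s * G s) * ennreal (K * t powr (?n - 2 + a)))"
          proof (cases "s \<in> Q")
            case True
            then show ?thesis
              using growth[of s t] t by (intro mult_left_mono) (auto simp: Q_def)
          qed simp
        qed
        also have "\<dots> = (k t * ennreal (t powr - ?n) * ennreal (K * t powr (?n - 2 + a))) * (\<integral>\<^sup>+s. indicator Q s * G s \<partial>lborel)"
        proof -
          have "(\<integral>\<^sup>+s. (k t * ennreal (t powr - ?n)) * ((indicator Q s * G s) * ennreal (K * t powr (?n - 2 + a))) \<partial>lborel)
            = (\<integral>\<^sup>+s. (k t * ennreal (t powr - ?n) * ennreal (K * t powr (?n - 2 + a))) * (indicator Q s * G s) \<partial>lborel)"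
            by (simp only: mult_ac)
          also have "\<dots> = (k t * ennreal (t powr - ?n) * ennreal (K * t powr (?n - 2 + a))) * (\<integral>\<^sup>+s. indicator Q s * G s \<partial>lborel)"
            by (rule nn_integral_cmult) measurable
          finally show ?thesis .
        qed
        also have "k t * ennreal (t powr - ?n) * ennreal (K * t powr (?n - 2 + a)) = ennreal K * ennreal (t powr (d - 1))"
        proof -
          have "t powr (1 - d) * t powr - ?n * (K * t powr (?n - 2 + a)) = K * (t powr (1 - d) * t powr - ?n * t powr (?n - 2 + a))"
            by simp
          also have "t powr (1 - d) * t powr - ?n * t powr (?n - 2 + a) = t powr (d - 1)"
            by (simp add: powr_add[symmetric] d_def field_simps)
          finally show ?thesis using True K by (simp add: k_def ennreal_mult'[symmetric])
        qed
        finally show ?thesis using True by (simp add: mult_ac)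
      qed
    qed
  qed
  also have "\<dots> = ennreal K * (\<integral>\<^sup>+s. indicator Q s * G s \<partial>lborel) * ennreal (1 / d)"
    by (subst nn_integral_cmult) (auto simp: nn_integral_powr_unit_interval d)
  finally have "(\<integral>\<^sup>+y. \<integral>\<^sup>+z. indicator Q y * (indicator Q z * w z) * ennreal ((norm (u y - u z))\<^sup>2) \<partial>lborel \<partial>lborel)
     \<le> ennreal L * (ennreal K * (\<integral>\<^sup>+s. indicator Q s * G s \<partial>lborel) * ennreal (1 / d))"
    by (simp add: mult_left_mono)
  also have "\<dots> = ennreal (L * K * (1 / d)) * (\<integral>\<^sup>+s. indicator Q s * G s \<partial>lborel)"
  proof -
    have "0 \<le> L" using d by (simp add: L_def)
    then have "ennreal (L * K * (1 / d)) = ennreal L * ennreal K * ennreal (1 / d)"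
      using K d by (subst ennreal_mult; simp)+
    then show ?thesis by (simp only: mult_ac)
  qed
  also have "L * K * (1 / d) = 16 * ?n\<^sup>2 * K / a\<^sup>2 * r\<^sup>2"
    using a by (simp add: L_def d_def power2_eq_square field_simps)
  finally show ?thesis by (simp add: Q_def G_def)
qed

section \<open>The inequality on a critical cube\<close>

lemma pd_matrix_inv:
  fixes A :: "real^'d^'d"
  assumes "pd_matrix A"
  shows pd_matrix_inv_left: "matrix_inv A ** A = mat 1"
    and psd_matrix_inv: "psd_matrix (matrix_inv A)"
proof -
  have sym: "transpose A = A" and pos: "\<And>e. e \<noteq> 0 \<Longrightarrow> 0 < (A *v e) \<bullet> e"
    using assms by (auto simp: pd_matrix_def)
  have "A *v e = 0 \<Longrightarrow> e = 0" for e using pos[of e] by (cases "e = 0") auto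
  then have "invertible A"
    using matrix_left_invertible_ker[of A] invertible_left_inverse by blast
  then have inv: "A ** matrix_inv A = mat 1 \<and> matrix_inv A ** A = mat 1"
    unfolding invertible_def matrix_inv_def by (rule someI_ex)
  then show "matrix_inv A ** A = mat 1" by simp
  have r: "A ** matrix_inv A = mat 1" using inv by simp
  have "transpose (matrix_inv A) ** A = mat 1"
    by (metis matrix_transpose_mul r sym transpose_mat)
  then have "transpose (matrix_inv A) = matrix_inv A"
    by (metis matrix_mul_assoc matrix_mul_lid matrix_mul_rid r)
  moreover have "0 \<le> (matrix_inv A *v v) \<bullet> v" for v
  proof -
    define w where "w = matrix_inv A *v v"
    have "v = A *v w" by (simp add: w_def matrix_vector_mul_assoc r)
    then have "(matrix_inv A *v v) \<bullet> v = (A *v w) \<bullet> w"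
      unfolding w_def[symmetric] by (metis inner_commute)
    then show ?thesis using pos[of w] by (cases "w = 0") auto
  qed
  ultimately show "psd_matrix (matrix_inv A)" by (simp add: psd_matrix_def)
qed

text \<open>The matrix \<open>T\<close> is \<open>A\<^sup>-\<^sup>1\<^sup>/\<^sup>2\<close>. Of its relation to \<open>A\<close> only \<open>T\<^sup>2 = A\<^sup>-\<^sup>1\<close> is known by construction; \<open>T A T = 1\<close> follows
  because \<open>T A\<close> is a right inverse, hence the inverse, of \<open>T\<close>.\<close>

lemma inverse_sqrt_whitens:
  fixes A :: "real^'d^'d"
  assumes "pd_matrix A"
  defines "T \<equiv> msqrt (matrix_inv A)"
  shows "(A *v (T *v v)) \<bullet> (T *v v) = (norm v)\<^sup>2"
proof -
  have psd: "psd_matrix (matrix_inv A)" by (rule psd_matrix_inv) fact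
  have TT: "T ** T = matrix_inv A" unfolding T_def by (rule msqrt_square[OF psd])
  have symT: "transpose T = T" using psd_msqrt[OF psd] by (simp add: T_def psd_matrix_def)
  have "T ** (T ** A) = mat 1" by (simp add: matrix_mul_assoc TT pd_matrix_inv_left[OF assms(1)])
  then have TAT: "(T ** A) ** T = mat 1" by (simp add: matrix_left_right_inverse[of T])
  have "(A *v (T *v v)) \<bullet> (T *v v) = (T *v (A *v (T *v v))) \<bullet> v"
    by (simp only: symmetric_matrix_inner[OF symT])
  also have "T *v (A *v (T *v v)) = v"
    using TAT by (simp add: matrix_vector_mul_assoc matrix_mul_assoc)
  finally show ?thesis by (simp add: power2_norm_eq_inner)
qed

lemma quadratic_form_sandwich:
  fixes B S :: "real^'d^'d"
  assumes B: "psd_matrix B" and S: "transpose S = S"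
  shows "((S ** B ** S) *v e) \<bullet> e = (norm (msqrt B *v (S *v e)))\<^sup>2"
proof -
  have "((S ** B ** S) *v e) \<bullet> e = (S *v (B *v (S *v e))) \<bullet> e"
    by (simp add: matrix_vector_mul_assoc matrix_mul_assoc)
  also have "\<dots> = (B *v (S *v e)) \<bullet> (S *v e)" by (rule symmetric_matrix_inner[OF S])
  finally show ?thesis by (simp add: norm_msqrt_squared[OF B])
qed

text \<open>The operator norm of \<open>T S\<close> is at most its Frobenius norm, and its rows are the columns of the transpose
  \<open>S T\<close>. In this order the sum is \<open>\<Sum>\<langle>S\<^sup>2 T e\<^sub>i, T e\<^sub>i\<rangle>\<close>, a sum of scalar densities when \<open>S\<^sup>2\<close> is the weight.\<close>

lemma norm_product_le_columns:
  fixes S T :: "real^'d^'d"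
  assumes S: "transpose S = S" and T: "transpose T = T"
  shows "(norm (T *v (S *v v)))\<^sup>2 \<le> (\<Sum>i\<in>UNIV. (norm (S *v (T *v axis i 1)))\<^sup>2) * (norm v)\<^sup>2"
proof -
  have "(T ** S) $ i = S *v (T *v axis i 1)" for i
  proof -
    have "S *v (T *v axis i 1) = (S ** T) *v axis i 1" by (simp add: matrix_vector_mul_assoc)
    also have "S ** T = transpose (T ** S)" by (simp add: matrix_transpose_mul S T)
    also have "transpose (T ** S) *v axis i 1 = (T ** S) $ i"
      by (simp add: matrix_vector_mul_component[symmetric] matrix_vector_mult_basis column_transpose row_def vec_eq_iff)
    finally show ?thesis ..
  qed
  then have "(norm (T ** S))\<^sup>2 = (\<Sum>i\<in>UNIV. (norm (S *v (T *v axis i 1)))\<^sup>2)"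
    by (simp add: norm_vec_def[of "T ** S"] L2_set_def sum_nonneg)
  moreover have "(norm (T *v (S *v v)))\<^sup>2 \<le> (norm (T ** S) * norm v)\<^sup>2"
    using norm_matrix_vector_le[of "T ** S" v] by (intro power_mono) (auto simp: matrix_vector_mul_assoc)
  ultimately show ?thesis by (simp add: power_mult_distrib)
qed

lemma norm_add_squared_le: "(norm (a + b))\<^sup>2 \<le> 2 * (norm a)\<^sup>2 + 2 * (norm (b :: 'a :: real_normed_vector))\<^sup>2"
proof -
  have "(norm (a + b))\<^sup>2 \<le> (norm a + norm b)\<^sup>2" by (intro power_mono norm_triangle_ineq) auto
  also have "\<dots> \<le> 2 * (norm a)\<^sup>2 + 2 * (norm b)\<^sup>2"
    using sum_squares_bound[of "norm a" "norm b"] by (simp add: power2_sum)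
  finally show ?thesis .
qed

text \<open>If \<open>f\<close> is not integrable, its Bochner integral is 0 by convention. This lets the \<open>NC\<close> condition be used
  although its integrand contains the square root of the weight, whose measurability is not established here.\<close>

lemma ennreal_integral_le_nn_integral:
  assumes "\<And>x. 0 \<le> f x"
  shows "ennreal (integral\<^sup>L M f) \<le> (\<integral>\<^sup>+x. ennreal (f x) \<partial>M)"
proof (cases "integrable M f")
  case True
  then show ?thesis using nn_integral_eq_integral[OF True] assms by simp
qed (simp add: not_integrable_integral_eq)

context doubling_weight
begin

lemma pd_critical: "pd_matrix (weight_of V (cube x (\<rho> x)))"
  by (rule pd_weight_of_cube[OF \<rho>_pos])

definition whiten :: "real^'n \<Rightarrow> real^'d^'d" where
  "whiten x = msqrt (matrix_inv (weight_of V (cube x (\<rho> x))))"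

lemma whiten_sym: "transpose (whiten x) = whiten x"
  using psd_msqrt[OF psd_matrix_inv[OF pd_critical]] by (simp add: whiten_def psd_matrix_def)

lemma mass_whiten: "mass V (whiten x *v v) (cube x (\<rho> x)) = (norm v)\<^sup>2"
  unfolding whiten_def by (rule inverse_sqrt_whitens[OF pd_critical])

lemma norm_whiten_le: "\<rho> x powr (real CARD('n) - 2) * (norm (whiten x *v v))\<^sup>2 \<le> D * (norm v)\<^sup>2"
  using critical_cube_lower_bound[of x "whiten x *v v"] by (simp add: mass_whiten)

text \<open>The trace of \<open>A\<^sup>-\<^sup>1 V(z)\<close> with \<open>A = V(Q\<^sub>x)\<close>, written as a sum of densities of mass one on \<open>Q\<^sub>x\<close>.\<close>

definition normalized_density :: "real^'n \<Rightarrow> real^'n \<Rightarrow> real" where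
  "normalized_density x z = (\<Sum>i\<in>UNIV. (V z *v (whiten x *v axis i 1)) \<bullet> (whiten x *v axis i 1))"

lemma normalized_density_nonneg: "0 \<le> normalized_density x z"
  unfolding normalized_density_def by (intro sum_nonneg V_nonneg)

lemma quad_meas[measurable]: "(\<lambda>z. (V z *v e) \<bullet> e) \<in> borel_measurable lebesgue"
  by (rule measurable_compose[OF V_meas])
    (intro borel_measurable_continuous_onI linear_continuous_on linear_quadratic_form)

lemma normalized_density_meas[measurable]: "normalized_density x \<in> borel_measurable lebesgue"
  unfolding normalized_density_def by measurable

lemma quad_field_meas:
  fixes u :: "real^'n \<Rightarrow> real^'d"
  assumes "continuous_on UNIV u"
  shows "(\<lambda>z. (V z *v u z) \<bullet> u z) \<in> borel_measurable lebesgue"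
proof (rule borel_measurable_continuous_Pair[OF V_meas, where g = u and H = "\<lambda>A v. (A *v v) \<bullet> v"])
  show "u \<in> borel_measurable lebesgue"
    using borel_measurable_continuous_onI[OF assms] by (intro measurable_completion) simp
  show "continuous_on UNIV (\<lambda>x :: (real^'d^'d) \<times> (real^'d). (fst x *v snd x) \<bullet> snd x)"
    unfolding matrix_vector_mult_def inner_vec_def by (simp, intro continuous_intros)
qed

lemma sqrt_field_eq: "ennreal ((norm (msqrt (V z) *v v))\<^sup>2) = ennreal ((V z *v v) \<bullet> v)"
  by (simp add: norm_msqrt_squared V_psd)

lemma normalized_density_growth:
  assumes s: "s \<in> cube x (\<rho> x)" and t: "0 < t" "t \<le> 1"
  shows "(\<integral>\<^sup>+z. indicator (cube x (\<rho> x)) z * indicator (cube s (2 * \<rho> x * t)) z * ennreal (normalized_density x z) \<partial>lebesgue)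
    \<le> ennreal (real CARD('d) * (2 * C * 2 ^ CARD('n)) * t powr (real CARD('n) - 2 + \<alpha>))"
proof -
  let ?n = "real CARD('n)"
  define Q where "Q = cube x (\<rho> x)"
  define E where "E = Q \<inter> cube s (2 * \<rho> x * t)"
  define b where "b i = whiten x *v axis i 1" for i
  have r: "0 < \<rho> x" by (rule \<rho>_pos)
  have E: "E \<subseteq> Q" "E \<in> sets lebesgue" by (auto simp: E_def Q_def)
  have "measure lebesgue E \<le> measure lebesgue (cube s (2 * \<rho> x * t))"
    using E by (intro measure_mono_fmeasurable cube_lmeasurable) (auto simp: E_def)
  then have "measure lebesgue E / measure lebesgue Q \<le> (2 * (2 * \<rho> x * t)) ^ CARD('n) / (2 * \<rho> x) ^ CARD('n)"
    using r t by (simp add: Q_def measure_cube divide_right_mono del: measure_completion)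
  also have "\<dots> = (2 * t) powr ?n"
    using r t by (subst power_divide[symmetric]) (simp add: powr_realpow)
  finally have "(measure lebesgue E / measure lebesgue Q) powr (1 - 1 / p) \<le> ((2 * t) powr ?n) powr (1 - 1 / p)"
    using p by (intro powr_mono2) auto
  also have "\<dots> = 2 powr (?n - 2 + \<alpha>) * t powr (?n - 2 + \<alpha>)"
    using t by (simp add: powr_powr powr_mult[symmetric] \<alpha>_def algebra_simps)
  also have "\<dots> \<le> 2 powr ?n * t powr (?n - 2 + \<alpha>)"
    using \<alpha> by (intro mult_right_mono powr_mono) auto
  finally have ratio: "(measure lebesgue E / measure lebesgue Q) powr (1 - 1 / p) \<le> 2 ^ CARD('n) * t powr (?n - 2 + \<alpha>)"
    by (simp add: powr_realpow)
  have mass_b: "mass V (b i) E \<le> 2 * C * (2 ^ CARD('n) * t powr (?n - 2 + \<alpha>))" for i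
  proof -
    have "mass V (b i) Q = 1" by (simp add: b_def Q_def mass_whiten norm_axis_1)
    then have "mass V (b i) E \<le> 2 * C * (measure lebesgue E / measure lebesgue Q) powr (1 - 1 / p)"
      using mass_subset_bound[OF r, of E x "b i"] E by (simp add: Q_def del: measure_completion)
    also have "\<dots> \<le> 2 * C * (2 ^ CARD('n) * t powr (?n - 2 + \<alpha>))"
      using ratio C by (intro mult_left_mono) auto
    finally show ?thesis .
  qed
  have "(\<integral>\<^sup>+z. indicator Q z * indicator (cube s (2 * \<rho> x * t)) z * ennreal (normalized_density x z) \<partial>lebesgue)
     = (\<integral>\<^sup>+z. (\<Sum>i\<in>UNIV. ennreal (indicator E z *\<^sub>R ((V z *v b i) \<bullet> b i))) \<partial>lebesgue)"
    by (rule nn_integral_cong) (auto simp: E_def normalized_density_def b_def indicator_def sum_ennreal V_nonneg)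
  also have "\<dots> = (\<Sum>i\<in>UNIV. (\<integral>\<^sup>+z. ennreal (indicator E z *\<^sub>R ((V z *v b i) \<bullet> b i)) \<partial>lebesgue))"
    by (intro nn_integral_sum measurable_compose[OF _ measurable_ennreal] borel_measurable_scaleR
        borel_measurable_indicator E quad_meas)
  also have "\<dots> = (\<Sum>i\<in>UNIV. ennreal (mass V (b i) E))"
  proof (rule sum.cong[OF refl])
    fix i
    have VE: "set_integrable lebesgue E V" using E unfolding Q_def by (rule V_integrable)
    show "(\<integral>\<^sup>+z. ennreal (indicator E z *\<^sub>R ((V z *v b i) \<bullet> b i)) \<partial>lebesgue) = ennreal (mass V (b i) E)"
      unfolding mass_eq[OF VE] set_lebesgue_integral_def
      using set_integrable_quadratic_form[OF VE, of "b i"]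
      by (intro nn_integral_eq_integral) (auto simp: set_integrable_def V_nonneg)
  qed
  also have "\<dots> = ennreal (\<Sum>i\<in>UNIV. mass V (b i) E)"
    using E by (intro sum_ennreal mass_nonneg[of _ x "\<rho> x"]) (auto simp: Q_def)
  also have "\<dots> \<le> ennreal (\<Sum>i\<in>(UNIV :: 'd set). 2 * C * (2 ^ CARD('n) * t powr (?n - 2 + \<alpha>)))"
    by (intro ennreal_leI sum_mono mass_b)
  finally show ?thesis by (simp add: Q_def mult_ac)
qed

text \<open>The condition \<open>NC\<close> at the vector \<open>u(y)\<close>, which is split as \<open>(u(y) - u(z)) + u(z)\<close>. The first part is
  estimated by the Frobenius norm of \<open>A\<^sup>-\<^sup>1\<^sup>/\<^sup>2 V\<^sup>1\<^sup>/\<^sup>2(z)\<close>, the second by the norm of \<open>A\<^sup>-\<^sup>1\<^sup>/\<^sup>2\<close> alone.\<close>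

lemma nondegeneracy_pointwise:
  fixes u :: "real^'n \<Rightarrow> real^'d"
  assumes NC: "NC_const V N" and u: "continuous_on UNIV u"
  shows "ennreal (N * (norm (u y))\<^sup>2) \<le>
    2 * (\<integral>\<^sup>+z. indicator (cube x (\<rho> x)) z * ennreal (normalized_density x z) * ennreal ((norm (u y - u z))\<^sup>2) \<partial>lebesgue)
    + ennreal (2 * D * \<rho> x powr (2 - real CARD('n))) *
       (\<integral>\<^sup>+z. indicator (cube x (\<rho> x)) z * ennreal ((norm (msqrt (V z) *v u z))\<^sup>2) \<partial>lebesgue)"
proof -
  define Q where "Q = cube x (\<rho> x)"
  define T where "T = whiten x"
  define W where "W = matrix_inv (weight_of V Q)"
  define c where "c = D * \<rho> x powr (2 - real CARD('n))"
  let ?S = "\<lambda>z. msqrt (V z)"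
  have r: "0 < \<rho> x" by (rule \<rho>_pos)
  have c: "c \<ge> 0" using D by (simp add: c_def)
  have W: "psd_matrix W" unfolding W_def Q_def by (rule psd_matrix_inv[OF pd_critical])
  have symS: "transpose (?S z) = ?S z" for z using psd_msqrt[OF V_psd[of z]] by (simp add: psd_matrix_def)
  have form: "((?S z ** W ** ?S z) *v e) \<bullet> e = (norm (T *v (?S z *v e)))\<^sup>2" for z e
    using quadratic_form_sandwich[OF W symS] by (simp add: T_def whiten_def W_def Q_def)
  have T_le: "(norm (T *v v))\<^sup>2 \<le> c * (norm v)\<^sup>2" for v
  proof -
    have "(norm (T *v v))\<^sup>2 = \<rho> x powr (2 - real CARD('n)) * (\<rho> x powr (real CARD('n) - 2) * (norm (T *v v))\<^sup>2)"
      using r by (simp add: mult.assoc[symmetric] powr_add[symmetric])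
    also have "\<dots> \<le> \<rho> x powr (2 - real CARD('n)) * (D * (norm v)\<^sup>2)"
      unfolding T_def by (intro mult_left_mono norm_whiten_le) auto
    finally show ?thesis by (simp add: c_def mult_ac)
  qed
  have TS_le: "(norm (T *v (?S z *v v)))\<^sup>2 \<le> normalized_density x z * (norm v)\<^sup>2" for z v
    using norm_product_le_columns[OF symS whiten_sym, of x z v]
    by (simp add: T_def normalized_density_def norm_msqrt_squared V_psd)
  have split: "(norm (T *v (?S z *v u y)))\<^sup>2 \<le>
      2 * (normalized_density x z * (norm (u y - u z))\<^sup>2) + 2 * c * (norm (?S z *v u z))\<^sup>2" for z
  proof -
    have "T *v (?S z *v u y) = T *v (?S z *v (u y - u z)) + T *v (?S z *v u z)"
      by (simp add: matrix_vector_mult_diff_distrib)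
    then have "(norm (T *v (?S z *v u y)))\<^sup>2 \<le>
      2 * (norm (T *v (?S z *v (u y - u z))))\<^sup>2 + 2 * (norm (T *v (?S z *v u z)))\<^sup>2"
      by (simp only: norm_add_squared_le)
    then show ?thesis using TS_le[of z "u y - u z"] T_le[of "?S z *v u z"] by linarith
  qed
  have [measurable]: "u \<in> borel_measurable lebesgue"
    using borel_measurable_continuous_onI[OF u] by (intro measurable_completion) simp
  have [measurable]: "(\<lambda>z. ennreal ((norm (?S z *v u z))\<^sup>2)) \<in> borel_measurable lebesgue"
    unfolding sqrt_field_eq using quad_field_meas[OF u] by measurable
  have [measurable]: "Q \<in> sets lebesgue" by (simp add: Q_def)
  have "N * (norm (u y))\<^sup>2 \<le> (LINT z:Q|lebesgue. ((?S z ** W ** ?S z) *v u y) \<bullet> u y)"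
    using NC unfolding NC_const_def Let_def lower_m_eq W_def Q_def by (auto simp: field_simps)
  also have "\<dots> = (LINT z|lebesgue. indicator Q z *\<^sub>R (norm (T *v (?S z *v u y)))\<^sup>2)"
    by (simp add: form set_lebesgue_integral_def)
  finally have "ennreal (N * (norm (u y))\<^sup>2) \<le> ennreal (LINT z|lebesgue. indicator Q z *\<^sub>R (norm (T *v (?S z *v u y)))\<^sup>2)"
    by (rule ennreal_leI)
  also have "\<dots> \<le> (\<integral>\<^sup>+z. ennreal (indicator Q z *\<^sub>R (norm (T *v (?S z *v u y)))\<^sup>2) \<partial>lebesgue)"
    by (rule ennreal_integral_le_nn_integral) auto
  also have "\<dots> \<le> (\<integral>\<^sup>+z. 2 * (indicator Q z * ennreal (normalized_density x z) * ennreal ((norm (u y - u z))\<^sup>2))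
      + ennreal (2 * c) * (indicator Q z * ennreal ((norm (?S z *v u z))\<^sup>2)) \<partial>lebesgue)"
  proof (rule nn_integral_mono)
    fix z
    show "ennreal (indicator Q z *\<^sub>R (norm (T *v (?S z *v u y)))\<^sup>2) \<le>
      2 * (indicator Q z * ennreal (normalized_density x z) * ennreal ((norm (u y - u z))\<^sup>2))
      + ennreal (2 * c) * (indicator Q z * ennreal ((norm (?S z *v u z))\<^sup>2))"
    proof (cases "z \<in> Q")
      case True
      have "ennreal ((norm (T *v (?S z *v u y)))\<^sup>2)
         \<le> ennreal (2 * (normalized_density x z * (norm (u y - u z))\<^sup>2) + 2 * c * (norm (?S z *v u z))\<^sup>2)"
        by (rule ennreal_leI[OF split])
      also have "\<dots> = ennreal (2 * (normalized_density x z * (norm (u y - u z))\<^sup>2)) + ennreal (2 * c * (norm (?S z *v u z))\<^sup>2)"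
        using c normalized_density_nonneg[of x z] by (intro ennreal_plus) auto
      also have "\<dots> = 2 * (ennreal (normalized_density x z) * ennreal ((norm (u y - u z))\<^sup>2))
          + ennreal (2 * c) * ennreal ((norm (?S z *v u z))\<^sup>2)"
        using c normalized_density_nonneg[of x z] by (simp add: ennreal_mult)
      finally show ?thesis using True by simp
    qed simp
  qed
  also have "\<dots> = 2 * (\<integral>\<^sup>+z. indicator Q z * ennreal (normalized_density x z) * ennreal ((norm (u y - u z))\<^sup>2) \<partial>lebesgue)
    + ennreal (2 * c) * (\<integral>\<^sup>+z. indicator Q z * ennreal ((norm (?S z *v u z))\<^sup>2) \<partial>lebesgue)"
    by (simp add: nn_integral_add nn_integral_cmult)
  finally show ?thesis by (simp add: Q_def c_def mult.assoc)
qed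

definition local_const :: real where
  "local_const = 32 * (real CARD('n))\<^sup>2 * (real CARD('d) * (2 * C * 2 ^ CARD('n))) / \<alpha>\<^sup>2 + 2 * D * 2 ^ CARD('n)"

lemma local_const_pos: "0 < local_const"
  using C D \<alpha> by (auto simp: local_const_def intro!: add_nonneg_pos)

text \<open>Integrating the pointwise estimate over \<open>y\<close> produces the double integral of \<open>weighted_poincare\<close> and,
  in the other term, the volume of the cube, which turns \<open>\<rho>\<^sup>2\<^sup>-\<^sup>n\<close> into \<open>\<rho>\<^sup>2\<close>.\<close>

lemma local_inequality:
  fixes u :: "real^'n \<Rightarrow> real^'d"
  assumes NC: "NC_const V N"
    and diff: "\<And>x. u differentiable (at x)"
    and cont: "continuous_on UNIV (\<lambda>x. jacobian u (at x))"
  shows "ennreal N * (\<integral>\<^sup>+y. indicator (cube x (\<rho> x)) y * ennreal ((norm (u y))\<^sup>2) \<partial>lebesgue)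
    \<le> ennreal (local_const * (\<rho> x)\<^sup>2) *
      ((\<integral>\<^sup>+y. indicator (cube x (\<rho> x)) y * ennreal ((norm (jacobian u (at y)))\<^sup>2) \<partial>lebesgue)
       + (\<integral>\<^sup>+y. indicator (cube x (\<rho> x)) y * ennreal ((norm (msqrt (V y) *v u y))\<^sup>2) \<partial>lebesgue))"
proof -
  let ?n = "real CARD('n)"
  define Q where "Q = cube x (\<rho> x)"
  define K where "K = real CARD('d) * (2 * C * 2 ^ CARD('n))"
  define X where "X = (\<integral>\<^sup>+y. indicator Q y * ennreal ((norm (jacobian u (at y)))\<^sup>2) \<partial>lebesgue)"
  define Y where "Y = (\<integral>\<^sup>+y. indicator Q y * ennreal ((norm (msqrt (V y) *v u y))\<^sup>2) \<partial>lebesgue)"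
  have r: "0 < \<rho> x" by (rule \<rho>_pos)
  have N: "0 < N" using NC by (simp add: NC_const_def)
  have K: "0 \<le> K" using C by (simp add: K_def)
  have u: "continuous_on UNIV u"
    using diff differentiable_imp_continuous_within by (fastforce simp: continuous_on_eq_continuous_within)
  have [measurable]: "u \<in> borel_measurable borel" using u by (rule borel_measurable_continuous_onI)
  have [measurable]: "Q \<in> sets borel" by (simp add: Q_def)
  \<comment> \<open>a Borel version of the density, so that Tonelli's theorem applies to products of Borel measures\<close>
  obtain w where w[measurable]: "w \<in> borel_measurable lborel" and w_eq: "AE z in lborel. ennreal (normalized_density x z) = w z"
    using completion_ex_borel_measurable[of "\<lambda>z. ennreal (normalized_density x z)" lborel] by auto
  have repl: "(\<integral>\<^sup>+z. F z * ennreal (normalized_density x z) * G z \<partial>lebesgue) = (\<integral>\<^sup>+z. F z * w z * G z \<partial>lborel)" for F G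
    unfolding nn_integral_completion using w_eq by (intro nn_integral_cong_AE) auto
  have poincare: "(\<integral>\<^sup>+y. \<integral>\<^sup>+z. indicator Q y * (indicator Q z * w z) * ennreal ((norm (u y - u z))\<^sup>2) \<partial>lborel \<partial>lborel)
     \<le> ennreal (16 * ?n\<^sup>2 * K / \<alpha>\<^sup>2 * (\<rho> x)\<^sup>2) * X"
    unfolding X_def Q_def nn_integral_completion
  proof (rule weighted_poincare[OF diff cont _ r \<alpha>(1) K])
    show "w \<in> borel_measurable borel" using w by simp
    fix s t assume "s \<in> cube x (\<rho> x)" "0 < (t::real)" "t \<le> 1"
    then show "(\<integral>\<^sup>+z. indicator (cube x (\<rho> x)) z * indicator (cube s (2 * \<rho> x * t)) z * w z \<partial>lborel)
       \<le> ennreal (K * t powr (?n - 2 + \<alpha>))"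
      using normalized_density_growth[of s x t] repl[of "\<lambda>z. indicator (cube x (\<rho> x)) z * indicator (cube s (2 * \<rho> x * t)) z" "\<lambda>z. 1"]
      by (simp add: K_def)
  qed
  have "ennreal N * (\<integral>\<^sup>+y. indicator Q y * ennreal ((norm (u y))\<^sup>2) \<partial>lebesgue)
     = (\<integral>\<^sup>+y. indicator Q y * ennreal (N * (norm (u y))\<^sup>2) \<partial>lborel)"
    unfolding nn_integral_completion using N
    by (subst nn_integral_cmult[symmetric]) (auto simp: ennreal_mult mult_ac intro!: nn_integral_cong)
  also have "\<dots> \<le> (\<integral>\<^sup>+y. indicator Q y * (2 * (\<integral>\<^sup>+z. indicator Q z * w z * ennreal ((norm (u y - u z))\<^sup>2) \<partial>lborel)
       + ennreal (2 * D * \<rho> x powr (2 - ?n)) * Y) \<partial>lborel)"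
    using nondegeneracy_pointwise[OF NC u, of _ x] unfolding repl Q_def[symmetric] Y_def[symmetric]
    by (intro nn_integral_mono mult_left_mono) auto
  also have "\<dots> = (\<integral>\<^sup>+y. 2 * (\<integral>\<^sup>+z. indicator Q y * (indicator Q z * w z) * ennreal ((norm (u y - u z))\<^sup>2) \<partial>lborel)
       + ennreal (2 * D * \<rho> x powr (2 - ?n)) * Y * indicator Q y \<partial>lborel)"
  proof (rule nn_integral_cong)
    fix y
    have "(\<integral>\<^sup>+z. indicator Q y * (indicator Q z * w z) * ennreal ((norm (u y - u z))\<^sup>2) \<partial>lborel)
       = indicator Q y * (\<integral>\<^sup>+z. indicator Q z * w z * ennreal ((norm (u y - u z))\<^sup>2) \<partial>lborel)"
      by (subst nn_integral_cmult[symmetric]) (auto simp: mult_ac)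
    then show "indicator Q y * (2 * (\<integral>\<^sup>+z. indicator Q z * w z * ennreal ((norm (u y - u z))\<^sup>2) \<partial>lborel)
       + ennreal (2 * D * \<rho> x powr (2 - ?n)) * Y)
      = 2 * (\<integral>\<^sup>+z. indicator Q y * (indicator Q z * w z) * ennreal ((norm (u y - u z))\<^sup>2) \<partial>lborel)
       + ennreal (2 * D * \<rho> x powr (2 - ?n)) * Y * indicator Q y"
      by (simp add: indicator_def)
  qed
  also have "\<dots> = 2 * (\<integral>\<^sup>+y. \<integral>\<^sup>+z. indicator Q y * (indicator Q z * w z) * ennreal ((norm (u y - u z))\<^sup>2) \<partial>lborel \<partial>lborel)
       + ennreal (2 * D * \<rho> x powr (2 - ?n)) * Y * emeasure lborel Q"
    by (simp add: nn_integral_add nn_integral_cmult nn_integral_cmult_indicator)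
  also have "\<dots> \<le> 2 * (ennreal (16 * ?n\<^sup>2 * K / \<alpha>\<^sup>2 * (\<rho> x)\<^sup>2) * X)
       + ennreal (2 * D * \<rho> x powr (2 - ?n)) * Y * emeasure lborel Q"
    by (intro add_right_mono mult_left_mono poincare) auto
  also have "emeasure lborel Q = ennreal ((2 * \<rho> x) ^ CARD('n))"
  proof -
    have "emeasure lborel Q = ennreal (measure lborel Q)"
      by (rule emeasure_eq_ennreal_measure) (use emeasure_lborel_cbox_finite in \<open>auto simp: Q_def cube_def less_top\<close>)
    then show ?thesis using r by (simp add: Q_def measure_cube)
  qed
  also have "2 * (ennreal (16 * ?n\<^sup>2 * K / \<alpha>\<^sup>2 * (\<rho> x)\<^sup>2) * X)
       + ennreal (2 * D * \<rho> x powr (2 - ?n)) * Y * ennreal ((2 * \<rho> x) ^ CARD('n))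
     = ennreal (32 * ?n\<^sup>2 * K / \<alpha>\<^sup>2 * (\<rho> x)\<^sup>2) * X + ennreal (2 * D * 2 ^ CARD('n) * (\<rho> x)\<^sup>2) * Y"
  proof (rule arg_cong2[where f="(+)"])
    have "32 * ?n\<^sup>2 * K / \<alpha>\<^sup>2 * (\<rho> x)\<^sup>2 = 2 * (16 * ?n\<^sup>2 * K / \<alpha>\<^sup>2 * (\<rho> x)\<^sup>2)" by simp
    moreover have "ennreal (2 * (16 * ?n\<^sup>2 * K / \<alpha>\<^sup>2 * (\<rho> x)\<^sup>2)) = ennreal 2 * ennreal (16 * ?n\<^sup>2 * K / \<alpha>\<^sup>2 * (\<rho> x)\<^sup>2)"
      using K by (intro ennreal_mult) auto
    ultimately show "2 * (ennreal (16 * ?n\<^sup>2 * K / \<alpha>\<^sup>2 * (\<rho> x)\<^sup>2) * X) = ennreal (32 * ?n\<^sup>2 * K / \<alpha>\<^sup>2 * (\<rho> x)\<^sup>2) * X"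
      by (simp only: mult.assoc ennreal_numeral)
    have "\<rho> x powr (2 - ?n) * (2 * \<rho> x) ^ CARD('n) = 2 ^ CARD('n) * (\<rho> x)\<^sup>2"
    proof -
      have "\<rho> x powr (2 - ?n) = (\<rho> x)\<^sup>2 / \<rho> x ^ CARD('n)"
        using r by (simp add: powr_diff powr_realpow)
      then show ?thesis using r by (simp add: power_mult_distrib)
    qed
    then have "2 * D * \<rho> x powr (2 - ?n) * (2 * \<rho> x) ^ CARD('n) = 2 * D * 2 ^ CARD('n) * (\<rho> x)\<^sup>2"
      by (simp only: mult.assoc)
    moreover have "ennreal (2 * D * \<rho> x powr (2 - ?n)) * Y * ennreal ((2 * \<rho> x) ^ CARD('n))
       = ennreal (2 * D * \<rho> x powr (2 - ?n) * (2 * \<rho> x) ^ CARD('n)) * Y"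
    proof -
      have "ennreal (2 * D * \<rho> x powr (2 - ?n) * (2 * \<rho> x) ^ CARD('n))
         = ennreal (2 * D * \<rho> x powr (2 - ?n)) * ennreal ((2 * \<rho> x) ^ CARD('n))"
        using D r by (intro ennreal_mult) auto
      then show ?thesis by (simp only: mult_ac)
    qed
    ultimately show "ennreal (2 * D * \<rho> x powr (2 - ?n)) * Y * ennreal ((2 * \<rho> x) ^ CARD('n))
       = ennreal (2 * D * 2 ^ CARD('n) * (\<rho> x)\<^sup>2) * Y" by (simp only:)
  qed
  also have "\<dots> \<le> ennreal (local_const * (\<rho> x)\<^sup>2) * X + ennreal (local_const * (\<rho> x)\<^sup>2) * Y"
  proof (intro add_mono mult_right_mono ennreal_leI)
    have "0 \<le> 32 * ?n\<^sup>2 * K / \<alpha>\<^sup>2" "0 \<le> 2 * D * 2 ^ CARD('n)" using K D by auto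
    then show "32 * ?n\<^sup>2 * K / \<alpha>\<^sup>2 \<le> local_const" "2 * D * 2 ^ CARD('n) \<le> local_const"
      unfolding local_const_def K_def[symmetric] by simp_all
  qed auto
  finally show ?thesis by (simp add: Q_def X_def Y_def distrib_left)
qed

section \<open>Bounded overlap and the global inequality\<close>

definition overlap_const :: real where
  "overlap_const = (20 * real CARD('n) / \<eta>\<^sup>2) ^ CARD('n)"

text \<open>A volume count: all critical cubes containing \<open>y\<close> have radius comparable to \<open>\<rho>(y)\<close>, so cubes of one common
  size fit into the disjoint balls and into one cube about \<open>y\<close>.\<close>

lemma card_overlap_le:
  assumes disj: "pairwise (\<lambda>i j. disjnt (ball i (\<rho> i / 5)) (ball j (\<rho> j / 5))) F"
    and F: "finite F" "\<And>i. i \<in> F \<Longrightarrow> y \<in> cube i (\<rho> i)"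
  shows "real (card F) \<le> overlap_const"
proof -
  let ?n = "real CARD('n)"
  \<comment> \<open>a cube of half side \<open>s\<close> has Euclidean radius at most \<open>n s \<le> \<rho>(i) / 10\<close>\<close>
  define s where "s = \<eta> * \<rho> y / (10 * ?n)"
  define R where "R = \<rho> y / \<eta>"
  have y: "0 < \<rho> y" by (rule \<rho>_pos)
  have s: "0 < s" using \<eta> y by (simp add: s_def)
  have R: "0 < R" using \<eta> y by (simp add: R_def)
  have sR: "s \<le> R"
  proof -
    have "s \<le> \<eta> * \<rho> y / 1" unfolding s_def using \<eta> y n by (intro divide_left_mono) auto
    also have "\<dots> \<le> 1 * \<rho> y / \<eta>"
      using \<eta> y mult_mono[of \<eta> 1 \<eta> 1] by (simp add: field_simps)
    finally show ?thesis by (simp add: R_def)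
  qed
  have in_ball: "cube i s \<subseteq> ball i (\<rho> i / 5)" if "i \<in> F" for i
  proof
    fix z assume z: "z \<in> cube i s"
    have "norm (z - i) \<le> (\<Sum>j\<in>UNIV. \<bar>(z - i) $ j\<bar>)" by (rule norm_le_l1_cart)
    also have "\<dots> \<le> (\<Sum>j\<in>(UNIV :: 'n set). s)"
      using z by (intro sum_mono) (auto simp: mem_cube)
    also have "\<dots> = \<eta> * \<rho> y / 10" by (simp add: s_def)
    also have "\<dots> \<le> \<rho> i / 10" using \<rho>_upper_on_cube[OF F(2)[OF that]] by simp
    also have "\<dots> < \<rho> i / 5" using \<rho>_pos[of i] by simp
    finally show "z \<in> ball i (\<rho> i / 5)" by (simp add: dist_norm norm_minus_commute)
  qed
  have in_cube: "cube i s \<subseteq> cube y (2 * R)" if "i \<in> F" for i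
  proof
    fix z assume z: "z \<in> cube i s"
    have "\<rho> i \<le> R" using \<rho>_lower_on_cube[OF F(2)[OF that]] \<eta> by (simp add: R_def field_simps)
    have "\<bar>z $ j - y $ j\<bar> \<le> 2 * R" for j
    proof -
      have "\<bar>z $ j - i $ j\<bar> \<le> s" "\<bar>y $ j - i $ j\<bar> \<le> \<rho> i" using z F(2)[OF that] by (auto simp: mem_cube)
      then show ?thesis using \<open>\<rho> i \<le> R\<close> sR by linarith
    qed
    then show "z \<in> cube y (2 * R)" by (simp add: mem_cube)
  qed
  have "real (card F) * (2 * s) ^ CARD('n) = (\<Sum>i\<in>F. measure lebesgue (cube i s))"
    using s by (simp add: measure_cube del: measure_completion)
  also have "\<dots> = measure lebesgue (\<Union>i\<in>F. cube i s)"
  proof (rule measure_UNION'[symmetric])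
    show "pairwise (\<lambda>i j. disjnt (cube i s) (cube j s)) F"
      using disj in_ball unfolding pairwise_def by (meson disjnt_subset1 disjnt_subset2)
  qed (use F cube_lmeasurable in auto)
  also have "\<dots> \<le> measure lebesgue (cube y (2 * R))"
    using in_cube F by (intro measure_mono_fmeasurable cube_lmeasurable sets.finite_UN) auto
  also have "\<dots> = (2 * (2 * R)) ^ CARD('n)" using R by (intro measure_cube) auto
  finally have "real (card F) \<le> (2 * (2 * R)) ^ CARD('n) / (2 * s) ^ CARD('n)"
    using s by (simp add: pos_le_divide_eq)
  also have "\<dots> = (2 * (2 * R) / (2 * s)) ^ CARD('n)" by (simp only: power_divide)
  also have "2 * (2 * R) / (2 * s) = 20 * ?n / \<eta>\<^sup>2"
    using y \<eta> by (simp add: R_def s_def power2_eq_square field_simps)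
  finally show ?thesis by (simp add: overlap_const_def)
qed

lemma finite_overlap:
  assumes disj: "pairwise (\<lambda>i j. disjnt (ball i (\<rho> i / 5)) (ball j (\<rho> j / 5))) I"
  shows "(\<integral>\<^sup>+i. indicator (cube i (\<rho> i)) y \<partial>count_space I) \<le> ennreal overlap_const"
proof -
  define J where "J = {i \<in> I. y \<in> cube i (\<rho> i)}"
  have le: "real (card F) \<le> overlap_const" if "F \<subseteq> J" "finite F" for F
    using that by (intro card_overlap_le[of F y] pairwise_subset[OF disj]) (auto simp: J_def)
  have fin: "finite J"
  proof (rule ccontr)
    assume "infinite J"
    then obtain F where "F \<subseteq> J" "finite F" "card F = nat \<lceil>overlap_const\<rceil> + 1"
      using infinite_arbitrarily_large by blast
    with le[of F] show False by linarith
  qed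
  have "(\<integral>\<^sup>+i. indicator (cube i (\<rho> i)) y \<partial>count_space I) = (\<integral>\<^sup>+i. indicator J i \<partial>count_space I)"
    by (rule nn_integral_cong) (auto simp: J_def indicator_def)
  also have "\<dots> = emeasure (count_space I) J"
    by (rule nn_integral_indicator) (auto simp: J_def)
  also have "\<dots> = ennreal (real (card J))"
    using fin by (subst emeasure_count_space_finite) (auto simp: J_def ennreal_of_nat_eq_real_of_nat)
  also have "\<dots> \<le> ennreal overlap_const" using le[of J] fin by (intro ennreal_leI) auto
  finally show ?thesis .
qed

text \<open>Vitali's lemma needs bounded radii: a critical cube at a point of \<open>K\<close> that is large compared with \<open>K\<close>
  contains the origin, so its radius is comparable to \<open>\<rho>(0)\<close>.\<close>

lemma critical_cubes_cover:
  assumes "bounded K"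
  obtains I where "countable I" "pairwise (\<lambda>i j. disjnt (ball i (\<rho> i / 5)) (ball j (\<rho> j / 5))) I"
    "K \<subseteq> (\<Union>i\<in>I. cube i (\<rho> i))"
proof -
  obtain B where B: "\<And>x. x \<in> K \<Longrightarrow> norm x \<le> B" using assms by (auto simp: bounded_iff)
  have bound: "0 < \<rho> x / 5 \<and> \<rho> x / 5 \<le> max B (\<rho> 0 / \<eta>) / 5" if x: "x \<in> K" for x
  proof (cases "\<rho> x \<le> B")
    case False
    have "\<bar>x $ i\<bar> \<le> \<rho> x" for i using component_le_norm_cart[of x i] B[OF x] False by linarith
    then have "0 \<in> cube x (\<rho> x)" by (simp add: mem_cube)
    then have "\<eta> * \<rho> x \<le> \<rho> 0" by (rule \<rho>_lower_on_cube)
    then show ?thesis using \<eta> \<rho>_pos[of x] by (simp add: field_simps le_max_iff_disj)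
  qed (use \<rho>_pos[of x] in auto)
  have "K \<subseteq> (\<Union>i\<in>K. ball i (\<rho> i / 5))" using \<rho>_pos by auto
  then obtain I where I: "countable I" "I \<subseteq> K"
    "pairwise (\<lambda>i j. disjnt (ball i (\<rho> i / 5)) (ball j (\<rho> j / 5))) I"
    "K \<subseteq> (\<Union>i\<in>I. ball i (5 * (\<rho> i / 5)))"
    by (rule Vitali_covering_lemma_balls[OF _ bound])
  have "ball i (\<rho> i) \<subseteq> cube i (\<rho> i)" for i
  proof
    fix z assume "z \<in> ball i (\<rho> i)"
    then have "norm (z - i) < \<rho> i" by (simp add: dist_norm norm_minus_commute)
    then show "z \<in> cube i (\<rho> i)"
      using component_le_norm_cart[of "z - i"] by (auto simp: mem_cube intro: order_trans[OF _ less_imp_le])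
  qed
  then have "K \<subseteq> (\<Union>i\<in>I. cube i (\<rho> i))" using I(4) by fastforce
  then show ?thesis using that[of I] I by blast
qed

text \<open>The local inequalities are summed over the cover. Since \<open>\<rho>\<close> is not known to be measurable, the integrand
  on the left is first replaced by a measurable majorant, in which \<open>\<rho>\<close> is evaluated at the centres of the
  cover only.\<close>

lemma fefferman_phong:
  fixes u :: "real^'n \<Rightarrow> real^'d"
  assumes NC: "NC_const V N" and u: "C1_compact_support u"
  shows "(\<integral>\<^sup>+x. ennreal ((norm (lower_m x V *\<^sub>R u x))\<^sup>2) \<partial>lebesgue)
    \<le> ennreal (local_const * overlap_const / (\<eta>\<^sup>2 * N)) *
      ((\<integral>\<^sup>+x. ennreal ((norm (jacobian u (at x)))\<^sup>2) \<partial>lebesgue)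
       + (\<integral>\<^sup>+x. ennreal ((norm (msqrt (V x) *v u x))\<^sup>2) \<partial>lebesgue))"
proof -
  have diff: "\<And>x. u differentiable (at x)" and cont: "continuous_on UNIV (\<lambda>x. jacobian u (at x))"
    and supp: "compact (closure {x. u x \<noteq> 0})"
    using u by (auto simp: C1_compact_support_def)
  have N: "0 < N" using NC by (simp add: NC_const_def)
  have ucont: "continuous_on UNIV u"
    using diff differentiable_imp_continuous_within by (fastforce simp: continuous_on_eq_continuous_within)
  define f where "f x = ennreal ((norm (jacobian u (at x)))\<^sup>2)" for x
  define g where "g x = ennreal ((norm (msqrt (V x) *v u x))\<^sup>2)" for x
  have um: "u \<in> borel_measurable lebesgue"
    using borel_measurable_continuous_onI[OF ucont] by (intro measurable_completion) simp
  have fm: "f \<in> borel_measurable lebesgue"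
  proof -
    have "(\<lambda>x. (norm (jacobian u (at x)))\<^sup>2) \<in> borel_measurable borel"
      by (intro borel_measurable_continuous_onI continuous_intros cont)
    then show ?thesis unfolding f_def by (intro measurable_completion) simp
  qed
  have gm: "g \<in> borel_measurable lebesgue"
    unfolding g_def sqrt_field_eq using quad_field_meas[OF ucont] by measurable
  note [measurable] = um fm gm
  have "bounded {x. u x \<noteq> 0}"
    by (rule bounded_subset[OF compact_imp_bounded[OF supp] closure_subset])
  then obtain I where I: "countable I"
    "pairwise (\<lambda>i j. disjnt (ball i (\<rho> i / 5)) (ball j (\<rho> j / 5))) I"
    "{x. u x \<noteq> 0} \<subseteq> (\<Union>i\<in>I. cube i (\<rho> i))"
    by (rule critical_cubes_cover)
  define Q where "Q i = cube i (\<rho> i)" for i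
  have [measurable]: "Q i \<in> sets lebesgue" for i by (simp add: Q_def)
  define c where "c = local_const / (\<eta>\<^sup>2 * N)"
  have c: "0 \<le> c" using local_const_pos N by (simp add: c_def)
  have "(\<integral>\<^sup>+x. ennreal ((norm (lower_m x V *\<^sub>R u x))\<^sup>2) \<partial>lebesgue)
    \<le> (\<integral>\<^sup>+x. \<integral>\<^sup>+i. ennreal (1 / (\<eta> * \<rho> i)\<^sup>2) * (indicator (Q i) x * ennreal ((norm (u x))\<^sup>2)) \<partial>count_space I \<partial>lebesgue)"
  proof (rule nn_integral_mono)
    fix x
    show "ennreal ((norm (lower_m x V *\<^sub>R u x))\<^sup>2)
      \<le> (\<integral>\<^sup>+i. ennreal (1 / (\<eta> * \<rho> i)\<^sup>2) * (indicator (Q i) x * ennreal ((norm (u x))\<^sup>2)) \<partial>count_space I)"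
    proof (cases "u x = 0")
      case False
      then obtain i where i: "i \<in> I" "x \<in> Q i" using I(3) by (auto simp: Q_def)
      have "\<eta> * \<rho> i \<le> \<rho> x" using i(2) unfolding Q_def by (rule \<rho>_lower_on_cube)
      then have "1 / (\<rho> x)\<^sup>2 \<le> 1 / (\<eta> * \<rho> i)\<^sup>2"
        using \<eta>(1) \<rho>_pos[of i] \<rho>_pos[of x] by (intro divide_left_mono power_mono mult_pos_pos zero_less_power) auto
      have "ennreal ((norm (lower_m x V *\<^sub>R u x))\<^sup>2) = ennreal (1 / (\<rho> x)\<^sup>2 * (norm (u x))\<^sup>2)"
        by (simp add: lower_m_eq power_divide power_mult_distrib)
      also have "\<dots> \<le> ennreal (1 / (\<eta> * \<rho> i)\<^sup>2 * (norm (u x))\<^sup>2)"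
        by (intro ennreal_leI mult_right_mono) (fact, simp)
      also have "\<dots> = ennreal (1 / (\<eta> * \<rho> i)\<^sup>2) * (indicator (Q i) x * ennreal ((norm (u x))\<^sup>2))"
        using i by (simp add: ennreal_mult[symmetric])
      also have "\<dots> = (\<integral>\<^sup>+j. ennreal (1 / (\<eta> * \<rho> j)\<^sup>2) * (indicator (Q j) x * ennreal ((norm (u x))\<^sup>2)) * indicator {i} j \<partial>count_space I)"
        using i by (subst nn_integral_indicator_singleton) auto
      also have "\<dots> \<le> (\<integral>\<^sup>+j. ennreal (1 / (\<eta> * \<rho> j)\<^sup>2) * (indicator (Q j) x * ennreal ((norm (u x))\<^sup>2)) \<partial>count_space I)"
        by (rule nn_integral_mono) (auto simp: indicator_def)
      finally show ?thesis .
    qed simp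
  qed
  also have "\<dots> = (\<integral>\<^sup>+i. \<integral>\<^sup>+x. ennreal (1 / (\<eta> * \<rho> i)\<^sup>2) * (indicator (Q i) x * ennreal ((norm (u x))\<^sup>2)) \<partial>lebesgue \<partial>count_space I)"
    by (rule nn_integral_count_space_nn_integral[OF I(1)]) measurable
  also have "\<dots> \<le> (\<integral>\<^sup>+i. \<integral>\<^sup>+x. ennreal c * (indicator (Q i) x * (f x + g x)) \<partial>lebesgue \<partial>count_space I)"
  proof (rule nn_integral_mono)
    fix i
    let ?k = "1 / ((\<eta> * \<rho> i)\<^sup>2 * N)"
    have pos: "0 < \<eta> * \<rho> i" using \<eta> \<rho>_pos by simp
    have k: "0 \<le> ?k" using N by simp
    have "(\<integral>\<^sup>+x. ennreal (1 / (\<eta> * \<rho> i)\<^sup>2) * (indicator (Q i) x * ennreal ((norm (u x))\<^sup>2)) \<partial>lebesgue)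
      = ennreal (1 / (\<eta> * \<rho> i)\<^sup>2) * (\<integral>\<^sup>+x. indicator (Q i) x * ennreal ((norm (u x))\<^sup>2) \<partial>lebesgue)"
      by (rule nn_integral_cmult) measurable
    also have "\<dots> = ennreal ?k * ennreal N * (\<integral>\<^sup>+x. indicator (Q i) x * ennreal ((norm (u x))\<^sup>2) \<partial>lebesgue)"
      using N pos by (simp add: ennreal_mult[symmetric])
    also have "\<dots> \<le> ennreal ?k * (ennreal (local_const * (\<rho> i)\<^sup>2) *
         ((\<integral>\<^sup>+x. indicator (Q i) x * f x \<partial>lebesgue) + (\<integral>\<^sup>+x. indicator (Q i) x * g x \<partial>lebesgue)))"
      unfolding mult.assoc f_def g_def Q_def
      by (intro mult_left_mono local_inequality[OF NC diff cont, unfolded mult.assoc]) auto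
    also have "\<dots> = ennreal c * (\<integral>\<^sup>+x. indicator (Q i) x * (f x + g x) \<partial>lebesgue)"
    proof -
      have "?k * (local_const * (\<rho> i)\<^sup>2) = c"
        using \<rho>_pos[of i] by (simp add: c_def power_mult_distrib)
      then have "ennreal ?k * ennreal (local_const * (\<rho> i)\<^sup>2) = ennreal c"
        using k local_const_pos by (subst ennreal_mult[symmetric]) auto
      then show ?thesis
        by (simp add: mult.assoc[symmetric] distrib_left nn_integral_add)
    qed
    also have "\<dots> = (\<integral>\<^sup>+x. ennreal c * (indicator (Q i) x * (f x + g x)) \<partial>lebesgue)"
      by (rule nn_integral_cmult[symmetric]) measurable
    finally show "(\<integral>\<^sup>+x. ennreal (1 / (\<eta> * \<rho> i)\<^sup>2) * (indicator (Q i) x * ennreal ((norm (u x))\<^sup>2)) \<partial>lebesgue)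
      \<le> (\<integral>\<^sup>+x. ennreal c * (indicator (Q i) x * (f x + g x)) \<partial>lebesgue)" .
  qed
  also have "\<dots> = (\<integral>\<^sup>+x. \<integral>\<^sup>+i. ennreal c * (indicator (Q i) x * (f x + g x)) \<partial>count_space I \<partial>lebesgue)"
    by (rule nn_integral_count_space_nn_integral[OF I(1), symmetric]) measurable
  also have "\<dots> \<le> (\<integral>\<^sup>+x. ennreal (c * overlap_const) * (f x + g x) \<partial>lebesgue)"
  proof (rule nn_integral_mono)
    fix x
    have "(\<integral>\<^sup>+i. ennreal c * (indicator (Q i) x * (f x + g x)) \<partial>count_space I)
      = (\<integral>\<^sup>+i. ennreal c * (f x + g x) * indicator (Q i) x \<partial>count_space I)"
      by (simp only: mult_ac)
    also have "\<dots> = ennreal c * (f x + g x) * (\<integral>\<^sup>+i. indicator (Q i) x \<partial>count_space I)"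
      by (rule nn_integral_cmult) simp
    also have "\<dots> \<le> ennreal c * (f x + g x) * ennreal overlap_const"
      unfolding Q_def by (intro mult_left_mono finite_overlap I) auto
    also have "\<dots> = ennreal (c * overlap_const) * (f x + g x)"
      using c \<eta> by (simp add: ennreal_mult overlap_const_def mult_ac)
    finally show "(\<integral>\<^sup>+i. ennreal c * (indicator (Q i) x * (f x + g x)) \<partial>count_space I)
      \<le> ennreal (c * overlap_const) * (f x + g x)" .
  qed
  also have "\<dots> = ennreal (c * overlap_const) * ((\<integral>\<^sup>+x. f x \<partial>lebesgue) + (\<integral>\<^sup>+x. g x \<partial>lebesgue))"
    by (simp add: nn_integral_cmult nn_integral_add)
  finally show ?thesis by (simp add: c_def f_def g_def)
qed

end

text \<open>Allows the reverse Hoelder constant to be assumed at least 1.\<close>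

lemma Bp_const_mono:
  fixes V :: "real^'n \<Rightarrow> real^'d^'d"
  assumes "Bp_class_weight p V" "Bp_const p V C" "C \<le> C'"
  shows "Bp_const p V C'"
  unfolding Bp_const_def
proof (intro allI impI)
  fix x :: "real^'n" and r :: real and e :: "real^'d"
  assume r: "0 < r"
  interpret Bp_class_weight p V by fact
  let ?m = "measure lebesgue (cube x r)"
  have "0 \<le> (((1 / ?m) *\<^sub>R weight_of V (cube x r)) *v e) \<bullet> e"
    using mass_nonneg[OF order_refl sets_cube(1), of x r e]
    by (simp add: scaleR_matrix_vector_assoc[symmetric])
  then have "C * ((((1 / ?m) *\<^sub>R weight_of V (cube x r)) *v e) \<bullet> e)
      \<le> C' * ((((1 / ?m) *\<^sub>R weight_of V (cube x r)) *v e) \<bullet> e)"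
    using assms(3) by (rule mult_right_mono[rotated])
  with assms(2) r show "((1 / ?m) * (LINT y:cube x r|lebesgue. ((V y *v e) \<bullet> e) powr p)) powr (1 / p)
      \<le> C' * ((((1 / ?m) *\<^sub>R weight_of V (cube x r)) *v e) \<bullet> e)"
    unfolding Bp_const_def by (blast intro: order_trans)
qed

theorem lemma4p2:
  fixes p C\<^sub>V N\<^sub>V :: real
  assumes "CARD('n::finite) \<ge> 3" and "CARD('d::finite) \<ge> 2"
    and "p > real CARD('n) / 2"
  shows "\<exists>C > 0. \<forall>V :: real^'n \<Rightarrow> real^'d^'d.
    V \<in> Bp_class p \<inter> ND_class \<inter> NC_class \<longrightarrow> Bp_const p V C\<^sub>V \<longrightarrow> NC_const V N\<^sub>V \<longrightarrow>
    (\<forall>u :: real^'n \<Rightarrow> real^'d. C1_compact_support u \<longrightarrow>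
      (\<integral>\<^sup>+ x. ennreal ((norm (lower_m x V *\<^sub>R u x))\<^sup>2) \<partial>lebesgue)
      \<le> ennreal C * ((\<integral>\<^sup>+ x. ennreal ((norm (jacobian u (at x)))\<^sup>2) \<partial>lebesgue)
          + (\<integral>\<^sup>+ x. ennreal ((norm (msqrt (V x) *v u x))\<^sup>2) \<partial>lebesgue)))"
proof (cases "0 < N\<^sub>V")
  case False
  then have "\<not> NC_const V N\<^sub>V" for V :: "real^'n \<Rightarrow> real^'d^'d" by (simp add: NC_const_def)
  then show ?thesis by (intro exI[of _ 1]) simp
next
  case True
  define C where "C = max 1 C\<^sub>V"
  have p: "1 < p" using assms by linarith
  have C: "1 \<le> C" by (simp add: C_def)
  obtain D where dbl: "1 \<le> D" "\<And>(V :: real^'n \<Rightarrow> real^'d^'d) e x r. Bp_weight p C V \<Longrightarrow> 0 < r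
      \<Longrightarrow> mass V e (cube x (2 * r)) \<le> D * mass V e (cube x r)"
    using doubling_constant_exists[OF p C] by blast
  define K where "K = doubling_weight.local_const TYPE('d) TYPE('n) p C D *
      doubling_weight.overlap_const TYPE('n) p C D / ((doubling_weight.\<eta> TYPE('n) p C D)\<^sup>2 * N\<^sub>V)"
  show ?thesis
  proof (intro exI[of _ "max 1 K"] conjI allI impI)
    fix V :: "real^'n \<Rightarrow> real^'d^'d" and u :: "real^'n \<Rightarrow> real^'d"
    assume hyps: "V \<in> Bp_class p \<inter> ND_class \<inter> NC_class" "Bp_const p V C\<^sub>V" "NC_const V N\<^sub>V"
      and u: "C1_compact_support u"
    have base: "Bp_class_weight p V" using hyps p by unfold_locales auto
    then have weight: "Bp_weight p C V"
      using Bp_const_mono[OF base hyps(2), of C] C by (simp add: Bp_weight_def Bp_weight_axioms_def C_def)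
    interpret Bp_weight p C V by fact
    interpret doubling_weight p C V D
      using assms hyps(1) dbl(1) dbl(2)[OF weight] by unfold_locales auto
    have "ennreal K \<le> ennreal (max 1 K)" by (intro ennreal_leI) simp
    then show "(\<integral>\<^sup>+ x. ennreal ((norm (lower_m x V *\<^sub>R u x))\<^sup>2) \<partial>lebesgue)
      \<le> ennreal (max 1 K) * ((\<integral>\<^sup>+ x. ennreal ((norm (jacobian u (at x)))\<^sup>2) \<partial>lebesgue)
          + (\<integral>\<^sup>+ x. ennreal ((norm (msqrt (V x) *v u x))\<^sup>2) \<partial>lebesgue))"
      using fefferman_phong[OF hyps(3) u] unfolding K_def[symmetric]
      by (meson mult_right_mono order_trans zero_le)
  qed simp
qed

end
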